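(* Let $L\in\{1,2,\ldots\}$ and $t_{L,L}\le\delta<1$. Then the function $g_\delta:=\chi_{\mathcal{C}_\delta(\eta)}\cdot P_L(\langle\cdot,\eta\rangle)$ is a minimizer of the extremal problem $$C_2(L,\delta):=\inf_{g\in\mathcal{Z}^2_\delta\setminus\{0\}}\;\sup_{h\in\mathcal{S}_L\setminus\{0\}}\frac{\|h\|_2^2\,\|g\|_2^2}{\|h\ast g\|_2^2},$$ and the minimum is given by $$C_2(L,\delta)=\left(2\pi\int_\delta^1P_L(t)^2\,dt\right)^{-1}.$$
   Context: $\mathbb{S}^2$ is the unit sphere in $\mathbb{R}^3$ with the rotation invariant surface measure $\sigma$ (total mass $4\pi$); $\|\cdot\|_2$ is the norm of $L^2(\mathbb{S}^2)$ with respect to $\sigma$; $\eta=(0,0,1)$ is the north pole. $P_l$ denotes the Legendre polynomial of degree $l$, normalized by $P_l(1)=1$; for $L\ge1$, $t_{L,L}$ is the largest zero of $P_L$. Let $Y_l^m$, $|m|\le l$, $l=0,1,\ldots$, be the standard spherical harmonics, orthonormal in $L^2(\mathbb{S}^2)$: in spherical coordinates (polar angle $\theta$, azimuth $\varphi$), $Y_l^m(\theta,\varphi)=\sqrt{\frac{2l+1}{4\pi}\frac{(l-m)!}{(l+m)!}}\,P_l^m(\cos\theta)e^{im\varphi}$, where $P_l^m(t)=\frac{(-1)^{m+l}}{2^l l!}(1-t^2)^{m/2}\frac{d^{m+l}}{dt^{m+l}}(1-t^2)^l$. $\mathcal{S}_L$ is the complex linear span of $\{Y_l^m:0\le l\le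 L,\ |m|\le l\}$. For $\delta\in[-1,1]$ and $x\in\mathbb{S}^2$, $\mathcal{C}_\delta(x)=\{y\in\mathbb{S}^2:\langle x,y\rangle\ge\delta\}$. A function $g$ on $\mathbb{S}^2$ is zonal if it depends only on the $z$-coordinate; it is then also regarded as a function on $[-1,1]$, with $g(x)=g(\langle x,\eta\rangle)$. $\mathcal{Z}^2_\delta$ is the set of zonal $g\in L^2(\mathbb{S}^2)$ whose support, as a function on $[-1,1]$, is contained in $[\delta,1]$ (equivalently, supported in $\mathcal{C}_\delta(\eta)$). Convolution with a zonal $g$ is $(f\ast g)(x)=\int_{\mathbb{S}^2}f(y)g(\langle x,y\rangle)\,d\sigma(y)$. The quotient is interpreted as $+\infty$ when $h\ast g=0$. *)

theory Defs
  imports "HOL-Analysis.Analysis" "HOL-Computational_Algebra.Polynomial"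
begin

section \<open>The sphere and its surface measure\<close>

abbreviation S2 :: "(real^3) set" where
  "S2 \<equiv> sphere 0 1"

definition north_pole :: "real^3" where
  "north_pole = vector [0, 0, 1]"

text \<open>The surface measure as cone measure: the area of \<open>A\<close> is three times the volume of the
  cone over \<open>A\<close> in the unit ball. It is characterized by being rotation invariant with total
  mass \<open>4\<pi>\<close>; see \<open>sphere_measure_rotation_invariant\<close> and \<open>emeasure_sphere_measure_S2\<close>.\<close>

definition sphere_measure :: "(real^3) measure" where
  "sphere_measure =
     scale_measure 3
       (distr (restrict_space lborel (ball 0 1 - {0})) (restrict_space borel S2)
          (\<lambda>x. x /\<^sub>R norm x))"

lemma space_sphere_measure [simp]: "space sphere_measure = S2"
  by (simp add: sphere_measure_def space_scale_measure space_restrict_space)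

lemma sets_sphere_measure [simp, measurable_cong]:
  "sets sphere_measure = sets (restrict_space borel S2)"
  by (simp add: sphere_measure_def)

lemma emeasure_sphere_measure:
  assumes "A \<in> sets sphere_measure"
  shows "emeasure sphere_measure A =
           3 * emeasure lborel {x \<in> ball 0 1 - {0}. x /\<^sub>R norm x \<in> A}"
proof -
  let ?B = "restrict_space lborel (ball 0 1 - {0} :: (real^3) set)"
  have A: "A \<in> sets (restrict_space borel S2)" using assms by simp
  have m: "(\<lambda>x. x /\<^sub>R norm x) \<in> measurable ?B (restrict_space borel S2)"
  proof (rule measurable_restrict_space2)
    show "(\<lambda>x. x /\<^sub>R norm x) \<in> space ?B \<rightarrow> S2"
      by (auto simp: space_restrict_space)
    show "(\<lambda>x. x /\<^sub>R norm x) \<in> borel_measurable ?B"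
      by (rule measurable_restrict_space1) measurable
  qed
  have sp: "(\<lambda>x. x /\<^sub>R norm x) -` A \<inter> space ?B = {x \<in> ball 0 1 - {0}. x /\<^sub>R norm x \<in> A}"
    by (auto simp: space_restrict_space)
  show ?thesis
    unfolding sphere_measure_def emeasure_scale_measure emeasure_distr[OF m A] sp
    by (subst emeasure_restrict_space) auto
qed

lemma emeasure_sphere_measure_S2: "emeasure sphere_measure S2 = ennreal (4 * pi)"
proof -
  have S: "S2 \<in> sets sphere_measure"
    by (simp add: sets_restrict_space_iff)
  have eq: "{x \<in> ball 0 1 - {0 :: real^3}. x /\<^sub>R norm x \<in> S2} = ball 0 1 - {0}"
    by auto
  have "emeasure lborel (ball 0 1 - {0 :: real^3}) = emeasure lborel (ball 0 1 :: (real^3) set)"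
    by (subst emeasure_Diff) auto
  also have "\<dots> = ennreal (4 / 3 * pi)"
    by (subst emeasure_ball) (auto simp: eval_unit_ball_vol)
  finally show ?thesis
    unfolding emeasure_sphere_measure[OF S] eq
    by (simp flip: ennreal_mult' ennreal_numeral)
qed

lemma sphere_measure_rotation_invariant:
  fixes f :: "real^3 \<Rightarrow> real^3"
  assumes f: "orthogonal_transformation f" and A: "A \<in> sets sphere_measure"
  shows "emeasure sphere_measure (f ` A) = emeasure sphere_measure A"
proof -
  let ?K = "\<lambda>A. {x \<in> ball 0 1 - {0 :: real^3}. x /\<^sub>R norm x \<in> A}"
  have lin: "linear f" and nm: "\<And>x. norm (f x) = norm x" and inj: "inj f"
    using f by (auto simp: orthogonal_transformation orthogonal_transformation_inj)
  have surj: "surj f" using f by (rule orthogonal_transformation_surj)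
  have A': "A \<in> sets borel" "A \<subseteq> S2"
    using A by (auto simp: sets_restrict_space_iff)
  have bij: "bij f" using inj surj by (simp add: bij_def)
  have fi: "f ` A = inv f -` A"
    using bij_vimage_eq_inv_image[OF bij_imp_bij_inv[OF bij]] inv_inv_eq[OF bij] by simp
  have "linear (inv f)"
    using f by (simp add: orthogonal_transformation_inv orthogonal_transformation_linear)
  then have "inv f \<in> borel_measurable borel"
    by (intro borel_measurable_continuous_onI linear_continuous_on
        linear_conv_bounded_linear[THEN iffD1])
  from measurable_sets[OF this A'(1)] have fA: "f ` A \<in> sets borel"
    unfolding fi by simp
  have fS: "f ` A \<subseteq> S2" using A'(2) nm by auto
  have fA': "f ` A \<in> sets sphere_measure"
    using fA fS by (auto simp: sets_restrict_space_iff)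
  have Kb: "?K B \<in> sets borel" if "B \<in> sets borel" for B
  proof -
    have "(\<lambda>x. x /\<^sub>R norm x :: real^3) \<in> borel_measurable borel" by measurable
    from measurable_sets[OF this that]
    have "(\<lambda>x. x /\<^sub>R norm x :: real^3) -` B \<inter> (ball 0 1 - {0}) \<in> sets borel" by auto
    also have "(\<lambda>x. x /\<^sub>R norm x :: real^3) -` B \<inter> (ball 0 1 - {0}) = ?K B" by auto
    finally show ?thesis .
  qed
  have Kl: "?K B \<in> lmeasurable" if "B \<in> sets borel" for B
    by (rule bounded_set_imp_lmeasurable) (use Kb[OF that] in \<open>auto intro: bounded_subset[OF bounded_ball[of 0 1]]\<close>)
  have fx: "f x /\<^sub>R norm x = f (x /\<^sub>R norm x)" for x
    using lin by (simp add: linear_cmul)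
  have f0: "f x = 0 \<longleftrightarrow> x = 0" for x
    using nm[of x] by (metis norm_eq_zero)
  have mem: "f x \<in> ?K (f ` A) \<longleftrightarrow> x \<in> ?K A" for x
    by (simp add: fx f0 nm inj_image_mem_iff[OF inj])
  have K: "?K (f ` A) = f ` ?K A"
  proof (rule set_eqI)
    fix y
    obtain x where y: "y = f x" using surj by (meson surjD)
    show "y \<in> ?K (f ` A) \<longleftrightarrow> y \<in> f ` ?K A"
      unfolding y mem inj_image_mem_iff[OF inj] ..
  qed
  have eml: "emeasure lborel (?K B) = ennreal (measure lebesgue (?K B))" if "B \<in> sets borel" for B
  proof -
    have "emeasure lborel (?K B) = emeasure lebesgue (?K B)"
      using Kb[OF that] by (simp only: emeasure_completion main_part sets_completionI_sets sets_lborel)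
    also have "\<dots> = ennreal (measure lebesgue (?K B))"
      by (rule emeasure_eq_measure2[OF Kl[OF that]])
    finally show ?thesis .
  qed
  have "measure lebesgue (?K (f ` A)) = measure lebesgue (?K A)"
    unfolding K by (rule measure_orthogonal_image[OF f Kl[OF A'(1)]])
  then show ?thesis
    unfolding emeasure_sphere_measure[OF A] emeasure_sphere_measure[OF fA']
      eml[OF A'(1)] eml[OF fA] by (rule arg_cong)
qed

section \<open>Square integrable functions\<close>

text \<open>Elements of \<open>L\<^sup>2\<close> are represented by functions \<open>real^3 \<Rightarrow> complex\<close>, of which only the
  restriction to \<open>S2\<close> matters.\<close>

definition L2_sphere :: "(real^3 \<Rightarrow> complex) set" where
  "L2_sphere = {f. f \<in> borel_measurable sphere_measure \<and>
                   integrable sphere_measure (\<lambda>x. (cmod (f x))\<^sup>2)}"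

definition L2_norm :: "(real^3 \<Rightarrow> complex) \<Rightarrow> real" where
  "L2_norm f = sqrt (LINT x|sphere_measure. (cmod (f x))\<^sup>2)"

definition L2_zero :: "(real^3 \<Rightarrow> complex) \<Rightarrow> bool" where
  "L2_zero f \<longleftrightarrow> (AE x in sphere_measure. f x = 0)"

section \<open>Legendre polynomials and spherical harmonics\<close>

definition legendre :: "nat \<Rightarrow> real poly" where
  "legendre l = smult (1 / (2 ^ l * fact l)) ((pderiv ^^ l) ([:-1, 0, 1:] ^ l))"

lemma poly_legendre_1: "poly (legendre l) 1 = 1"
proof -
  have *: "poly ((pderiv ^^ n) ([:-1, 1:] ^ n * q)) 1 = fact n * poly q 1" for n and q :: "real poly"
  proof (induction n arbitrary: q)
    case (Suc n)
    have "pderiv ([:-1, 1:] ^ Suc n * q) =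
            [:-1, 1:] ^ n * (smult (of_nat (Suc n)) q + [:-1, 1:] * pderiv q)"
      by (simp only: pderiv_mult pderiv_power_Suc) (simp add: pderiv_pCons algebra_simps)
    then show ?case
      by (simp only: funpow_Suc_right o_def Suc.IH) simp
  qed simp
  have "([:-1, 0, 1:] :: real poly) = [:-1, 1:] * [:1, 1:]" by simp
  then show ?thesis
    by (simp only: legendre_def power_mult_distrib poly_smult *) simp
qed

definition largest_legendre_zero :: "nat \<Rightarrow> real" where
  "largest_legendre_zero L = Max {t. poly (legendre L) t = 0}"

text \<open>The associated Legendre functions for \<open>\<bar>m\<bar> \<le> l\<close>. Writing \<open>(1 - t\<^sup>2)\<close> to the power \<open>m / 2\<close>
  as \<open>sqrt (1 - t\<^sup>2) powi m\<close> gives the correct (continuous) values at \<open>t = \<plusminus>1\<close>: one for \<open>m = 0\<close>,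
  zero for \<open>m > 0\<close>, and zero for \<open>m < 0\<close> by \<open>inverse 0 = 0\<close>.\<close>

definition assoc_legendre :: "nat \<Rightarrow> int \<Rightarrow> real \<Rightarrow> real" where
  "assoc_legendre l m t =
     (- 1) ^ nat (m + int l) / (2 ^ l * fact l) * sqrt (1 - t\<^sup>2) powi m
       * poly ((pderiv ^^ nat (m + int l)) ([:1, 0, -1:] ^ l)) t"

definition sph_harm_coord :: "nat \<Rightarrow> int \<Rightarrow> real \<Rightarrow> real \<Rightarrow> complex" where
  "sph_harm_coord l m \<theta> \<phi> =
     of_real (sqrt ((2 * real l + 1) / (4 * pi) * (fact (nat (int l - m)) / fact (nat (int l + m))))
                * assoc_legendre l m (cos \<theta>))
       * exp (\<i> * of_int m * of_real \<phi>)"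

text \<open>The polar angle of \<open>x \<in> S2\<close> is \<open>arccos (x $ 3)\<close>. The azimuth is immaterial at the poles,
  where \<open>sph_harm_coord l m\<close> vanishes for \<open>m \<noteq> 0\<close>.\<close>

definition sph_harm :: "nat \<Rightarrow> int \<Rightarrow> real^3 \<Rightarrow> complex" where
  "sph_harm l m x = sph_harm_coord l m (arccos (x $ 3)) (Arg (Complex (x $ 1) (x $ 2)))"

text \<open>The complex linear span of the \<open>sph_harm l m\<close> with \<open>l \<le> L\<close>, \<open>\<bar>m\<bar> \<le> l\<close>.\<close>

definition sph_harm_span :: "nat \<Rightarrow> (real^3 \<Rightarrow> complex) set" where
  "sph_harm_span L =
     {h. \<exists>c :: nat \<Rightarrow> int \<Rightarrow> complex.
           h = (\<lambda>x. \<Sum>l\<le>L. \<Sum>m\<in>{- int l..int l}. c l m * sph_harm l m x)}"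

section \<open>Zonal functions and convolution\<close>

definition cap :: "real \<Rightarrow> real^3 \<Rightarrow> (real^3) set" where
  "cap \<delta> x = {y \<in> S2. x \<bullet> y \<ge> \<delta>}"

definition zonal :: "(real^3 \<Rightarrow> complex) \<Rightarrow> bool" where
  "zonal g \<longleftrightarrow> (\<forall>x\<in>S2. \<forall>y\<in>S2. x $ 3 = y $ 3 \<longrightarrow> g x = g y)"

text \<open>A zonal function regarded as a function on \<open>[-1, 1]\<close>, evaluated along a meridian.\<close>

definition profile :: "(real^3 \<Rightarrow> complex) \<Rightarrow> real \<Rightarrow> complex" where
  "profile g t = g (vector [sqrt (1 - t\<^sup>2), 0, t])"

lemma zonal_eq_profile:
  assumes "zonal g" "x \<in> S2"
  shows "g x = profile g (x \<bullet> north_pole)"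
proof -
  have x: "(x $ 1)\<^sup>2 + (x $ 2)\<^sup>2 + (x $ 3)\<^sup>2 = 1"
    using assms(2) by (simp add: norm_eq_1 inner_vec_def sum_3 power2_eq_square)
  have i: "x \<bullet> north_pole = x $ 3"
    by (simp add: north_pole_def inner_vec_def sum_3)
  have "(x $ 3)\<^sup>2 \<le> 1"
    using x by (smt (verit) zero_le_power2)
  then have "vector [sqrt (1 - (x $ 3)\<^sup>2), 0, x $ 3] \<in> S2"
    by (simp add: norm_eq_1 inner_vec_def sum_3) (simp add: power2_eq_square)
  then show ?thesis
    using assms unfolding i profile_def zonal_def by fastforce
qed

text \<open>The support condition is the one for \<open>L\<^sup>2\<close> classes: \<open>g\<close> vanishes almost everywhere off the
  cap.\<close>

definition Z2 :: "real \<Rightarrow> (real^3 \<Rightarrow> complex) set" where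
  "Z2 \<delta> = {g \<in> L2_sphere. zonal g \<and>
                (AE x in sphere_measure. x \<notin> cap \<delta> north_pole \<longrightarrow> g x = 0)}"

definition sph_conv :: "(real^3 \<Rightarrow> complex) \<Rightarrow> (real^3 \<Rightarrow> complex) \<Rightarrow> real^3 \<Rightarrow> complex" where
  "sph_conv f g x = (LINT y|sphere_measure. f y * profile g (x \<bullet> y))"

section \<open>The extremal problem\<close>

definition quotient2 :: "(real^3 \<Rightarrow> complex) \<Rightarrow> (real^3 \<Rightarrow> complex) \<Rightarrow> ennreal" where
  "quotient2 g h =
     (if L2_zero (sph_conv h g) then \<infinity>
      else ennreal ((L2_norm h)\<^sup>2 * (L2_norm g)\<^sup>2 / (L2_norm (sph_conv h g))\<^sup>2))"

definition worst_quotient2 :: "nat \<Rightarrow> (real^3 \<Rightarrow> complex) \<Rightarrow> ennreal" where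
  "worst_quotient2 L g = (SUP h\<in>{h \<in> sph_harm_span L. \<not> L2_zero h}. quotient2 g h)"

definition C2 :: "nat \<Rightarrow> real \<Rightarrow> ennreal" where
  "C2 L \<delta> = (INF g\<in>{g \<in> Z2 \<delta>. \<not> L2_zero g}. worst_quotient2 L g)"

definition g_opt :: "nat \<Rightarrow> real \<Rightarrow> real^3 \<Rightarrow> complex" where
  "g_opt L \<delta> x =
     indicator (cap \<delta> north_pole) x * of_real (poly (legendre L) (x \<bullet> north_pole))"

end

theory Submission
  imports Defs
begin

text \<open>
  Convolution with a zonal function \<open>g\<close> multiplies every spherical harmonic of degree \<open>l\<close> by a number
  \<open>c\<^bsub>l\<^esub>(g)\<close>, the integral of \<open>P\<^bsub>l\<^esub> g\<close> over the sphere (Funk-Hecke, lemma \<open>sph_conv_harmonic\<close>). Different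
  degrees being orthogonal, the supremum over \<open>h\<close> is \<open>\<parallel>g\<parallel>\<^sup>2\<close> divided by the smallest \<open>\<bar>c\<^bsub>l\<^esub>(g)\<bar>\<^sup>2\<close>,
  \<open>l \<le> L\<close>, and the task is to make the smallest multiplier large for given norm.

  For \<open>g\<close> supported in the cap, \<open>c\<^bsub>L\<^esub>(g)\<close> is the bilinear pairing of \<open>g\<close> with \<open>g_opt\<close>, so Cauchy-Schwarz
  bounds \<open>\<bar>c\<^bsub>L\<^esub>(g)\<bar>\<close> by \<open>\<parallel>g_opt\<parallel> \<parallel>g\<parallel>\<close>; this gives the lower bound \<open>1 / \<parallel>g_opt\<parallel>\<^sup>2\<close> for every \<open>g\<close>
  (\<open>worst_quotient2_lower_bound\<close>). For \<open>g = g_opt\<close> equality holds in degree \<open>L\<close>, where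
  \<open>c\<^bsub>L\<^esub> = \<parallel>g_opt\<parallel>\<^sup>2\<close>. It remains to see that \<open>L\<close> is the worst degree for \<open>g_opt\<close>. This follows from
  \<open>0 \<le> P\<^bsub>L\<^esub> \<le> P\<^bsub>l\<^esub>\<close> on \<open>[\<delta>, 1]\<close> for \<open>l \<le> L\<close> (\<open>legendre_beyond_largest_zero\<close>), and it is here that
  \<open>\<delta>\<close> must not lie below the largest zero of \<open>P\<^bsub>L\<^esub>\<close>. The three-term recurrence yields both the sign and
  the monotonicity in the degree.

  The Funk-Hecke formula rests on a rotation invariant description of the harmonics of degree \<open>l\<close>: they
  are the polynomial functions of degree at most \<open>l\<close> on the sphere that are orthogonal to all
  polynomial functions of smaller degree. By invariance, a convolution need only be evaluated at the
  north pole. There a harmonic may be replaced by its average over the circles of latitude, a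
  polynomial in the height which is again orthogonal to lower degrees, with respect to Lebesgue
  measure on \<open>[-1, 1]\<close> by Archimedes' theorem (\<open>archimedes_hat_box\<close>), and hence a multiple of \<open>P\<^bsub>l\<^esub>\<close>.
  That the functions \<open>Y\<^bsub>l\<^esub>\<^bsup>m\<^esup>\<close> are harmonic in this sense is a matter of integrating the Rodrigues
  formula by parts (\<open>harmonic_sph_harm\<close>).
\<close>

section \<open>Legendre polynomials\<close>

lemma legendre_0 [simp]: "legendre 0 = 1"
  by (simp add: legendre_def)

lemma legendre_1: "legendre 1 = [:0, 1:]"
  by (simp add: legendre_def pderiv_pCons)

lemma degree_legendre_le: "degree (legendre l) \<le> l"
  by (simp add: legendre_def degree_higher_pderiv degree_power_eq)

lemma legendre_nonzero: "legendre l \<noteq> 0"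
  using poly_legendre_1[of l] by auto

lemma higher_pderiv_X_mult:
  fixes p :: "real poly"
  shows "(pderiv ^^ Suc n) ([:0, 1:] * p)
           = [:0, 1:] * (pderiv ^^ Suc n) p + smult (of_nat (Suc n)) ((pderiv ^^ n) p)"
proof (induction n)
  case 0
  show ?case by (simp add: pderiv_mult pderiv_pCons)
next
  case (Suc n)
  have "(pderiv ^^ Suc (Suc n)) ([:0, 1:] * p) = pderiv ((pderiv ^^ Suc n) ([:0, 1:] * p))"
    by simp
  also have "\<dots> = pderiv ([:0, 1:] * (pderiv ^^ Suc n) p) + smult (of_nat (Suc n)) ((pderiv ^^ Suc n) p)"
    by (simp only: Suc.IH pderiv_add pderiv_smult) simp
  also have "pderiv ([:0, 1:] * (pderiv ^^ Suc n) p)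
      = [:0, 1:] * (pderiv ^^ Suc (Suc n)) p + (pderiv ^^ Suc n) p"
    by (simp only: pderiv_mult) (simp add: pderiv_pCons)
  finally show ?case
    by (simp add: poly_eq_poly_eq_iff[symmetric] fun_eq_iff algebra_simps)
qed

text \<open>With \<open>w = t\<^sup>2 - 1\<close>, the first derivative of \<open>w ^ (l + 1)\<close> is \<open>2 (l + 1) t w ^ l\<close>, and the remaining
  \<open>l\<close> derivatives can be taken in two ways: all at once by the Leibniz rule, or with a first one in
  which \<open>t\<^sup>2\<close> is replaced by \<open>w + 1\<close>.\<close>

lemma legendre_recurrence:
  assumes "l \<ge> 1"
  shows "real (Suc l) * poly (legendre (Suc l)) t
           = real (2 * l + 1) * t * poly (legendre l) t - real l * poly (legendre (l - 1)) t"
proof -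
  define w :: "real poly" where "w = [:-1, 0, 1:]"
  obtain n where l: "l = Suc n" using assms by (cases l) auto
  define A where "A k = poly ((pderiv ^^ k) (w ^ k)) t" for k
  define B where "B = poly ((pderiv ^^ n) (w ^ Suc n)) t"
  have w': "pderiv w = smult 2 [:0, 1:]" and ww: "[:0, 1:] * [:0, 1:] = w + 1"
    by (simp_all add: w_def pderiv_pCons one_pCons)
  have d1: "pderiv (w ^ Suc k) = smult (2 * real (Suc k)) ([:0, 1:] * w ^ k)" for k
    unfolding pderiv_power_Suc w' by (simp add: mult.commute)
  have d2: "pderiv ([:0, 1:] * w ^ Suc n) = smult (real (2 * l + 1)) (w ^ Suc n) + smult (real (2 * l)) (w ^ n)"
  proof -
    have "pderiv ([:0, 1:] * w ^ Suc n)
        = w ^ Suc n + smult (2 * real (Suc n)) (([:0, 1:] * [:0, 1:]) * w ^ n)"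
      unfolding pderiv_mult d1 by (simp add: pderiv_pCons algebra_simps)
    also have "\<dots> = smult (real (2 * l + 1)) (w ^ Suc n) + smult (real (2 * l)) (w ^ n)"
      unfolding ww l by (simp add: poly_eq_poly_eq_iff[symmetric] fun_eq_iff algebra_simps)
    finally show ?thesis .
  qed
  have step: "(pderiv ^^ Suc (Suc n)) (w ^ Suc (Suc n))
      = smult (2 * real (Suc (Suc n))) ((pderiv ^^ Suc n) ([:0, 1:] * w ^ Suc n))"
    by (subst funpow_Suc_right) (simp only: o_def d1 higher_pderiv_smult)
  \<comment> \<open>Two expressions for the next Rodrigues derivative, both involving the same lower
    derivative \<open>B\<close>, which is then eliminated.\<close>
  have e1: "A (Suc l) = 2 * real (Suc l) * (t * A l + real l * B)"
    unfolding A_def l step higher_pderiv_X_mult by (simp add: B_def)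
  have "(pderiv ^^ Suc n) ([:0, 1:] * w ^ Suc n)
      = (pderiv ^^ n) (pderiv ([:0, 1:] * w ^ Suc n))"
    by (simp only: funpow_Suc_right o_def)
  then have e2: "A (Suc l) = 2 * real (Suc l) * (real (2 * l + 1) * B + real (2 * l) * A n)"
    unfolding A_def l step by (simp only: d2 l higher_pderiv_add higher_pderiv_smult) (simp add: B_def)
  have "real (2 * l + 1) * A (Suc l) - real l * A (Suc l)
      = 2 * real (Suc l) * (real (2 * l + 1) * t * A l - 2 * real l * real l * A n)"
    by (subst e1, subst e2) (simp add: algebra_simps)
  then have "real (Suc l) * A (Suc l)
      = real (Suc l) * (2 * (real (2 * l + 1) * t * A l - 2 * real l * real l * A n))"
    by (simp add: algebra_simps)
  then have e: "A (Suc l) = 2 * (real (2 * l + 1) * t * A l - 2 * real l * real l * A n)"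
    by (subst (asm) mult_cancel_left) simp
  have P: "A k = 2 ^ k * fact k * poly (legendre k) t" for k
    by (simp add: A_def legendre_def w_def)
  have "2 ^ Suc l * fact l * (real (Suc l) * poly (legendre (Suc l)) t) = A (Suc l)"
    by (simp add: P)
  also have "\<dots> = 2 ^ Suc l * fact l * (real (2 * l + 1) * t * poly (legendre l) t - real l * poly (legendre n) t)"
    by (subst e) (simp add: P l algebra_simps)
  finally show ?thesis
    by (simp add: l)
qed

text \<open>The recurrence can be written as
  \<open>(n + 1) (P\<^bsub>n+1\<^esub> - P\<^bsub>n\<^esub>) = (2 n + 1) (t - 1) P\<^bsub>n\<^esub> + n (P\<^bsub>n\<^esub> - P\<^bsub>n-1\<^esub>)\<close>: where the polynomials are
  nonnegative, a decreasing step is followed by a decreasing step.\<close>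

lemma legendre_decreasing_at:
  fixes t :: real
  assumes t: "t \<le> 1" and nonneg: "\<And>k. k \<le> L \<Longrightarrow> 0 \<le> poly (legendre k) t" and l: "l \<le> L"
  shows "poly (legendre L) t \<le> poly (legendre l) t"
proof -
  have legendre_step: "poly (legendre (Suc n)) t \<le> poly (legendre n) t" if "n < L" for n
    using that
  proof (induction n)
    case 0
    show ?case using t by (simp add: legendre_1[unfolded One_nat_def])
  next
    case (Suc n)
    let ?P = "\<lambda>n. poly (legendre n) t"
    have "real (Suc (Suc n)) * (?P (Suc (Suc n)) - ?P (Suc n))
        = real (2 * Suc n + 1) * (t - 1) * ?P (Suc n) + real (Suc n) * (?P (Suc n) - ?P n)"
      using legendre_recurrence[of "Suc n" t] by (simp add: algebra_simps)
    also have "\<dots> \<le> 0"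
      using t nonneg[of "Suc n"] Suc
      by (intro add_nonpos_nonpos mult_nonneg_nonpos mult_nonpos_nonneg) auto
    finally show ?case
      by (simp add: mult_le_0_iff)
  qed
  show ?thesis
    using l
  proof (induction rule: inc_induct)
    case (step n)
    then show ?case using legendre_step[of n] by simp
  qed simp
qed

text \<open>Take \<open>s\<close> to be the largest zero in \<open>[0, 1]\<close> of any of \<open>P\<^bsub>0\<^esub>, \<dots>, P\<^bsub>L\<^esub>\<close>; there is one because
  \<open>P\<^bsub>1\<^esub>\<close> vanishes at \<open>0\<close>. Since \<open>P\<^bsub>k\<^esub>(1) = 1\<close>, all these polynomials are nonnegative to the right of
  \<open>s\<close>, and the recurrence excludes that \<open>s\<close> is a zero of \<open>P\<^bsub>l\<^esub>\<close> with \<open>l < L\<close>: it would give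
  \<open>P\<^bsub>l+1\<^esub>(s) < 0\<close>.\<close>

lemma legendre_largest_zero:
  assumes "L \<ge> 1"
  obtains s where "0 \<le> s" "s < 1" "poly (legendre L) s = 0"
    "\<And>k t. k \<le> L \<Longrightarrow> s \<le> t \<Longrightarrow> t \<le> 1 \<Longrightarrow> 0 \<le> poly (legendre k) t"
proof -
  let ?P = "\<lambda>k. poly (legendre k)"
  define Z where "Z = (\<Union>k\<le>L. {t. ?P k t = 0}) \<inter> {0..1}"
  have fin: "finite Z"
    unfolding Z_def by (intro finite_Int disjI1 finite_UN_I) (use poly_roots_finite[OF legendre_nonzero] in auto)
  have "0 \<in> Z"
    using assms by (auto simp: Z_def legendre_1[unfolded One_nat_def] intro!: bexI[of _ "Suc 0"])
  then have ne: "Z \<noteq> {}" by auto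
  define s where "s = Max Z"
  have sZ: "s \<in> Z" unfolding s_def using fin ne by (rule Max_in)
  have s01: "0 \<le> s" "s < 1"
    using sZ poly_legendre_1 by (auto simp: Z_def less_le)
  have no_zero: "?P k t \<noteq> 0" if "k \<le> L" "s < t" "t \<le> 1" for k t
    using Max_ge[OF fin, of t] that s01 unfolding s_def[symmetric] by (auto simp: Z_def)
  have pos: "0 < ?P k t" if "k \<le> L" "s < t" "t \<le> 1" for k t
  proof (rule ccontr)
    assume "\<not> 0 < ?P k t"
    with no_zero[OF that] have neg: "?P k t < 0" by simp
    with that poly_legendre_1[of k] have "t < 1" by (auto simp: less_le)
    from poly_IVT_pos[OF this neg] obtain u where "t < u" "u < 1" "?P k u = 0"
      by (auto simp: poly_legendre_1)
    with no_zero[of k u] that show False by auto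
  qed
  have nonneg_s: "0 \<le> ?P k s" if "k \<le> L" for k
  proof (rule ccontr)
    assume "\<not> 0 \<le> ?P k s"
    then have "?P k s < 0" by simp
    from poly_IVT_pos[OF s01(2) this] obtain u where "s < u" "u < 1" "?P k u = 0"
      by (auto simp: poly_legendre_1)
    with no_zero[of k u] that show False by auto
  qed
  have nonneg: "0 \<le> ?P k t" if "k \<le> L" "s \<le> t" "t \<le> 1" for k t
    using nonneg_s[OF that(1)] pos[OF that(1), of t] that by (cases "t = s") auto
  define l where "l = (LEAST k. ?P k s = 0)"
  obtain k where k: "k \<le> L" "?P k s = 0" using sZ by (auto simp: Z_def)
  have l: "?P l s = 0" "l \<le> L"
    unfolding l_def using k by (auto intro: LeastI Least_le order_trans)
  have "l \<noteq> 0" using l by (auto intro: ccontr)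
  \<comment> \<open>At the first index vanishing at \<open>s\<close>, the recurrence makes the next polynomial negative.\<close>
  have "l = L"
  proof (rule ccontr)
    assume "l \<noteq> L"
    then have lL: "l < L" using l by simp
    have "?P (l - 1) s \<noteq> 0"
      using not_less_Least[of "l - 1" "\<lambda>k. ?P k s = 0"] \<open>l \<noteq> 0\<close> unfolding l_def[symmetric] by auto
    then have "0 < ?P (l - 1) s"
      using nonneg_s[of "l - 1"] lL by linarith
    moreover have "real (Suc l) * ?P (Suc l) s = - real l * ?P (l - 1) s"
      using legendre_recurrence[of l s] \<open>l \<noteq> 0\<close> l by simp
    moreover have "0 \<le> ?P (Suc l) s" using nonneg_s[of "Suc l"] lL by simp
    ultimately show False
      using \<open>l \<noteq> 0\<close> by (smt (verit) mult_nonneg_nonneg mult_pos_pos of_nat_0_le_iff of_nat_0_less_iff gr0I mult_minus_left)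
  qed
  with l have "?P L s = 0" by simp
  with s01 nonneg that show ?thesis by blast
qed

text \<open>The point \<open>s\<close> above is a zero of \<open>P\<^bsub>L\<^esub>\<close>, hence at most the largest one. Its existence also shows
  that the maximum in the definition of \<open>largest_legendre_zero\<close> is taken over a nonempty set.\<close>

lemma legendre_beyond_largest_zero:
  assumes "L \<ge> 1" "largest_legendre_zero L \<le> t" "t \<le> 1" "l \<le> L"
  shows "0 \<le> poly (legendre L) t" "poly (legendre L) t \<le> poly (legendre l) t" "0 \<le> t"
proof -
  obtain s where s: "0 \<le> s" "poly (legendre L) s = 0"
    "\<And>k t. k \<le> L \<Longrightarrow> s \<le> t \<Longrightarrow> t \<le> 1 \<Longrightarrow> 0 \<le> poly (legendre k) t"
    using legendre_largest_zero[OF assms(1)] by metis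
  have "s \<le> largest_legendre_zero L"
    unfolding largest_legendre_zero_def
    by (rule Max_ge) (use s poly_roots_finite[OF legendre_nonzero] in auto)
  with assms have st: "s \<le> t" by simp
  show "0 \<le> poly (legendre L) t" using s(3) st assms by simp
  show "0 \<le> t" using s st by simp
  show "poly (legendre L) t \<le> poly (legendre l) t"
    by (rule legendre_decreasing_at) (use s(3) st assms in auto)
qed

lemma power_dvd_higher_pderiv:
  fixes p r :: "real poly"
  assumes "r ^ n dvd p"
  shows "r ^ (n - k) dvd (pderiv ^^ k) p"
proof (induction k)
  case 0
  show ?case using assms by simp
next
  case (Suc k)
  then obtain q where q: "(pderiv ^^ k) p = r ^ (n - k) * q" by (elim dvdE)
  show ?case
  proof (cases "n - k")
    case (Suc m)
    have "r ^ m dvd pderiv (r ^ Suc m * q)"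
      unfolding pderiv_mult pderiv_power_Suc by (simp add: algebra_simps dvd_add dvd_smult)
    then show ?thesis using Suc q by (simp add: Suc_diff_Suc[symmetric] diff_Suc)
  qed (simp add: diff_Suc)
qed

lemma integral_pderiv:
  fixes p :: "real poly"
  assumes "a \<le> b"
  shows "integral {a..b} (poly (pderiv p)) = poly p b - poly p a"
  by (rule integral_unique, rule fundamental_theorem_of_calculus[OF assms])
     (simp add: has_real_derivative_iff_has_vector_derivative[symmetric] has_field_derivative_at_within poly_DERIV)

lemma poly_integrable [simp, intro]: "poly (p :: real poly) integrable_on {a..b}"
  by (intro integrable_continuous_real continuous_intros)

text \<open>Integration by parts \<open>n\<close> times leaves the \<open>n\<close>-th derivative of \<open>u\<close>, which is zero. The boundary
  terms vanish because at each stage one of the two factors is divisible by \<open>1 - t\<^sup>2\<close>: the Rodrigues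
  derivative as long as its order is below \<open>l\<close>, and a derivative of \<open>u\<close> otherwise. With \<open>n \<noteq> l\<close> the
  lemma serves the associated functions of order \<open>n - l\<close>.\<close>

lemma integral_mult_rodrigues_eq_0:
  fixes u :: "real poly"
  defines "w \<equiv> [:1, 0, -1:]"
  assumes "w ^ (n - l) dvd u" "degree u < n"
  shows "integral {-1..1} (poly (u * (pderiv ^^ n) (w ^ l))) = 0"
  using assms(2-)
proof (induction n arbitrary: u)
  case 0
  then show ?case by simp
next
  case (Suc n)
  let ?V = "(pderiv ^^ n) (w ^ l)"
  have "u * (pderiv ^^ Suc n) (w ^ l) = pderiv (u * ?V) - pderiv u * ?V"
    by (simp add: pderiv_mult)
  then have "integral {-1..1} (poly (u * (pderiv ^^ Suc n) (w ^ l)))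
      = integral {-1..1} (\<lambda>t. poly (pderiv (u * ?V)) t - poly (pderiv u * ?V) t)"
    by (simp only: poly_diff[abs_def])
  also have "\<dots> = integral {-1..1} (poly (pderiv (u * ?V))) - integral {-1..1} (poly (pderiv u * ?V))"
    by (rule integral_diff; rule poly_integrable)
  also have "integral {-1..1} (poly (pderiv (u * ?V))) = poly (u * ?V) 1 - poly (u * ?V) (-1)"
    by (rule integral_pderiv) simp
  finally have by_parts: "integral {-1..1} (poly (u * (pderiv ^^ Suc n) (w ^ l)))
      = poly (u * ?V) 1 - poly (u * ?V) (-1) - integral {-1..1} (poly (pderiv u * ?V))" .
  have boundary: "poly (u * ?V) x = 0" if "x = 1 \<or> x = -1" for x
  proof -
    have w: "poly w x = 0" using that by (auto simp: w_def)
    show ?thesis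
    proof (cases "n < l")
      case True
      have "w ^ (l - n) dvd ?V" by (rule power_dvd_higher_pderiv) simp
      with w True show ?thesis by (auto elim!: dvdE simp: poly_power)
    next
      case False
      with Suc.prems(1) w show ?thesis by (auto elim!: dvdE simp: poly_power Suc_diff_le)
    qed
  qed
  have "integral {-1..1} (poly (pderiv u * ?V)) = 0"
  proof (cases "degree u = 0")
    case True
    then have "pderiv u = 0" by (simp add: pderiv_eq_0_iff)
    then show ?thesis by (simp add: poly_0[abs_def])
  next
    case False
    have "w ^ (Suc n - l - 1) dvd pderiv u"
      using power_dvd_higher_pderiv[OF Suc.prems(1), of 1] by simp
    then have "w ^ (n - l) dvd pderiv u"
      by (metis diff_Suc_1 diff_commute)
    with Suc.prems(2) False show ?thesis
      by (intro Suc.IH) (auto simp: degree_pderiv)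
  qed
  then show ?case
    by (simp only: by_parts boundary[of 1] boundary[of "-1"] simp_thms)
qed

lemma legendre_rodrigues:
  "legendre l = smult ((-1) ^ l / (2 ^ l * fact l)) ((pderiv ^^ l) ([:1, 0, -1:] ^ l))"
proof -
  have "[:-1, 0, 1:] = smult (-1) [:1, 0, -1 :: real:]" by simp
  then have "[:-1, 0, 1:] ^ l = smult ((-1) ^ l) ([:1, 0, -1 :: real:] ^ l)"
    by (simp only: smult_power)
  then show ?thesis
    unfolding legendre_def by (simp add: higher_pderiv_smult)
qed

lemma legendre_orthogonal:
  assumes "degree q < l"
  shows "integral {-1..1} (\<lambda>t. poly (legendre l) t * poly q t) = 0"
proof -
  have "(\<lambda>t. poly (legendre l) t * poly q t)
     = (\<lambda>t. (-1) ^ l / (2 ^ l * fact l) * poly (q * (pderiv ^^ l) ([:1, 0, -1:] ^ l)) t)"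
    by (auto simp: fun_eq_iff legendre_rodrigues)
  then show ?thesis
    using integral_mult_rodrigues_eq_0[of l l q] assms
    by (simp only: integral_mult_right) (simp add: poly_mult[abs_def])
qed

lemma poly_eq_0_if_integral_eq_0:
  fixes p :: "real poly"
  assumes "a < b" "\<And>t. a \<le> t \<Longrightarrow> t \<le> b \<Longrightarrow> 0 \<le> poly p t" "integral {a..b} (poly p) = 0"
  shows "p = 0"
proof (rule ccontr)
  assume "p \<noteq> 0"
  then have "finite {t. poly p t = 0}" by (rule poly_roots_finite)
  moreover have "integral {a..b} (poly p) = 0 \<longleftrightarrow> (\<forall>t\<in>{a..b}. poly p t = 0)"
    using assms by (intro integral_eq_0_iff) (auto intro!: continuous_intros)
  with assms(3) have "\<And>t. t \<in> {a..b} \<Longrightarrow> poly p t = 0" by simp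
  then have "{a..b} \<subseteq> {t. poly p t = 0}" by auto
  ultimately have "finite {a..b}" by (rule finite_subset[rotated])
  with assms(1) show False by (simp add: infinite_Icc)
qed

lemma integral_poly_square_pos:
  fixes p :: "real poly"
  assumes "a < b" "p \<noteq> 0"
  shows "0 < integral {a..b} (\<lambda>t. (poly p t)\<^sup>2)"
proof -
  have e: "(\<lambda>t. (poly p t)\<^sup>2) = poly (p * p)" by (auto simp: power2_eq_square)
  have "integral {a..b} (poly (p * p)) \<noteq> 0"
    using poly_eq_0_if_integral_eq_0[OF assms(1), of "p * p"] assms(2) by auto
  moreover have "0 \<le> integral {a..b} (poly (p * p))"
    by (rule integral_nonneg) auto
  ultimately show ?thesis unfolding e by simp
qed

text \<open>The difference \<open>r\<close> of the two sides vanishes at \<open>1\<close>, so \<open>r = (t - 1) s\<close> with \<open>s\<close> of degree below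
  \<open>l\<close>, and orthogonality of \<open>r\<close> to \<open>s\<close> says that \<open>(1 - t) s\<^sup>2\<close> has integral zero.\<close>

lemma legendre_unique:
  fixes p :: "real poly"
  assumes deg: "degree p \<le> l"
    and orth: "\<And>q. degree q < l \<Longrightarrow> integral {-1..1} (\<lambda>t. poly p t * poly q t) = 0"
  shows "p = smult (poly p 1) (legendre l)"
proof -
  define r where "r = p - smult (poly p 1) (legendre l)"
  have r1: "poly r 1 = 0" by (simp add: r_def poly_legendre_1)
  have dr: "degree r \<le> l"
    unfolding r_def by (intro degree_diff_le deg order_trans[OF degree_smult_le] degree_legendre_le)
  have ro: "integral {-1..1} (\<lambda>t. poly r t * poly q t) = 0" if "degree q < l" for q
  proof -
    have "(\<lambda>t. poly r t * poly q t) = (\<lambda>t. poly (p * q) t - poly p 1 * poly (legendre l * q) t)"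
      by (auto simp: r_def algebra_simps)
    then have "integral {-1..1} (\<lambda>t. poly r t * poly q t)
        = integral {-1..1} (poly (p * q)) - integral {-1..1} (\<lambda>t. poly p 1 * poly (legendre l * q) t)"
      by (simp only:) (intro integral_diff integrable_on_mult_right poly_integrable)
    then show ?thesis
      using orth[OF that] legendre_orthogonal[OF that] by (simp add: poly_mult[abs_def])
  qed
  from r1 obtain s where s: "r = [:-1, 1:] * s"
    by (auto simp: poly_eq_0_iff_dvd elim!: dvdE)
  have "r = 0"
  proof (cases "degree s < l")
    case True
    have "integral {-1..1} (poly ([:1, -1:] * s * s)) = - integral {-1..1} (\<lambda>t. poly r t * poly s t)"
      unfolding integral_neg[symmetric] by (rule arg_cong2[where f = integral]) (auto simp: s algebra_simps)
    also have "\<dots> = 0" using ro[OF True] by simp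
    finally have "integral {-1..1} (poly ([:1, -1:] * s * s)) = 0" .
    moreover have "poly ([:1, -1:] * s * s) t = (1 - t) * (poly s t)\<^sup>2" for t
      by (simp add: power2_eq_square algebra_simps)
    ultimately have "[:1, -1:] * s * s = 0"
      by (intro poly_eq_0_if_integral_eq_0[of "-1" 1]) auto
    then have "s = 0" by (simp only: mult_eq_0_iff) auto
    then show ?thesis using s by simp
  next
    case False
    have "s = 0"
    proof (rule ccontr)
      assume "s \<noteq> 0"
      then have "degree r = degree s + 1"
        unfolding s by (subst degree_mult_eq) auto
      with False dr show False by simp
    qed
    then show ?thesis using s by simp
  qed
  then show ?thesis by (simp add: r_def)
qed

section \<open>Integration over the sphere\<close>

lemma sphere_coords: "x \<in> S2 \<longleftrightarrow> (x $ 1)\<^sup>2 + (x $ 2)\<^sup>2 + (x $ 3)\<^sup>2 = 1"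
  by (simp add: norm_eq_1 inner_vec_def sum_3 power2_eq_square)

lemma sphere_third_coord: "x \<in> S2 \<Longrightarrow> x $ 3 \<in> {-1..1}"
  using component_le_norm_cart[of x 3] by auto

lemma finite_measure_sphere: "finite_measure sphere_measure"
  by (rule finite_measureI) (simp add: emeasure_sphere_measure_S2)

interpretation sphere: finite_measure sphere_measure
  by (rule finite_measure_sphere)

lemma measurable_orthogonal_sphere:
  assumes "orthogonal_transformation f"
  shows "f \<in> measurable sphere_measure sphere_measure"
proof -
  have "linear f" using assms by (rule orthogonal_transformation_linear)
  then have "f \<in> borel_measurable borel"
    by (intro borel_measurable_continuous_onI linear_continuous_on linear_conv_bounded_linear[THEN iffD1])
  moreover have "f \<in> S2 \<rightarrow> S2"
    using orthogonal_transformation_norm[OF assms] by auto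
  ultimately have "f \<in> measurable (restrict_space borel S2) (restrict_space borel S2)"
    by (rule measurable_restrict_space3)
  then show ?thesis
    by (simp cong: measurable_cong_sets)
qed

lemma distr_sphere_orthogonal:
  assumes f: "orthogonal_transformation f"
  shows "distr sphere_measure sphere_measure f = sphere_measure"
proof (rule measure_eqI)
  fix A assume "A \<in> sets (distr sphere_measure sphere_measure f)"
  then have A: "A \<in> sets sphere_measure" by simp
  have bij: "bij f" using f by (rule orthogonal_transformation_bij)
  have inv: "orthogonal_transformation (inv f)" using f by (rule orthogonal_transformation_inv)
  have "A \<subseteq> S2" using sets.sets_into_space[OF A] by simp
  then have "f -` A \<inter> S2 = inv f ` A"
    using orthogonal_transformation_norm[OF inv] bij_vimage_eq_inv_image[OF bij] by auto
  then show "emeasure (distr sphere_measure sphere_measure f) A = emeasure sphere_measure A"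
    using emeasure_distr[OF measurable_orthogonal_sphere[OF f] A]
      sphere_measure_rotation_invariant[OF inv A] by simp
qed simp

lemma sphere_integral_orthogonal:
  fixes h :: "real^3 \<Rightarrow> 'b :: {banach, second_countable_topology}"
  assumes f: "orthogonal_transformation f" and h: "h \<in> borel_measurable sphere_measure"
  shows "(LINT x|sphere_measure. h (f x)) = (LINT x|sphere_measure. h x)"
  using integral_distr[OF measurable_orthogonal_sphere[OF f] h] distr_sphere_orthogonal[OF f] by simp

text \<open>The horizontal plane is taken to be \<open>complex\<close>, so that slices at constant height are
  Euclidean discs of a known area.\<close>

definition from_cylinder :: "real \<times> complex \<Rightarrow> real^3" where
  "from_cylinder = (\<lambda>(z, p). vector [Re p, Im p, z])"

lemma measurable_from_cylinder: "from_cylinder \<in> measurable lborel borel"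
proof -
  have alt: "from_cylinder = (\<lambda>q. \<chi> i. if i = 1 then Re (snd q) else if i = 2 then Im (snd q) else fst q)"
    by (auto simp: from_cylinder_def fun_eq_iff vec_eq_iff forall_3)
  have "continuous_on UNIV from_cylinder"
    unfolding alt
  proof (rule continuous_on_vec_lambda)
    fix i :: 3
    show "continuous_on UNIV (\<lambda>q :: real \<times> complex. if i = 1 then Re (snd q) else if i = 2 then Im (snd q) else fst q)"
      by (cases "i = 1"; cases "i = 2") (auto intro!: continuous_intros)
  qed
  then show ?thesis
    by (simp add: borel_measurable_continuous_onI)
qed

lemma lborel_cylindrical: "lborel = distr lborel borel from_cylinder"
proof (rule lborel_eqI)
  fix l u :: "real^3" assume le: "\<And>b. b \<in> Basis \<Longrightarrow> l \<bullet> b \<le> u \<bullet> b"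
  have le': "l $ i \<le> u $ i" for i
    using le[of "axis i 1"] by (simp add: inner_axis axis_in_Basis_iff)
  have B: "Basis = {axis 1 1, axis 2 1, axis 3 1 :: real^3}"
    by (auto simp: Basis_vec_def UNIV_3)
  have pre: "from_cylinder -` box l u
      = box (l $ 3) (u $ 3) \<times> box (Complex (l $ 1) (l $ 2)) (Complex (u $ 1) (u $ 2))"
    by (auto simp: from_cylinder_def box_def B inner_axis Basis_complex_def inner_complex_def)
  have "emeasure (distr lborel borel from_cylinder) (box l u) = emeasure lborel (from_cylinder -` box l u)"
    using emeasure_distr[OF measurable_from_cylinder, of "box l u"] by simp
  also have "\<dots> = emeasure (lborel \<Otimes>\<^sub>M lborel)
      (box (l $ 3) (u $ 3) \<times> box (Complex (l $ 1) (l $ 2)) (Complex (u $ 1) (u $ 2)))"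
    unfolding pre lborel_prod ..
  also have "\<dots> = emeasure lborel (box (l $ 3) (u $ 3))
      * emeasure lborel (box (Complex (l $ 1) (l $ 2)) (Complex (u $ 1) (u $ 2)))"
    by (rule lborel.emeasure_pair_measure_Times) auto
  also have "\<dots> = ennreal (u $ 3 - l $ 3) * ennreal ((u $ 1 - l $ 1) * (u $ 2 - l $ 2))"
    using le' by (subst (1 2) emeasure_lborel_box) (auto simp: Basis_complex_def inner_complex_def)
  also have "\<dots> = ennreal ((u $ 1 - l $ 1) * (u $ 2 - l $ 2) * (u $ 3 - l $ 3))"
    using le' by (subst ennreal_mult'[symmetric]) (auto simp: mult_ac)
  also have "\<dots> = ennreal (\<Prod>b\<in>Basis. (u - l) \<bullet> b)"
    by (simp add: B axis_eq_axis inner_axis mult_ac)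
  finally show "emeasure (distr lborel borel from_cylinder) (box l u) = ennreal (\<Prod>b\<in>Basis. (u - l) \<bullet> b)" .
qed simp

text \<open>By the definition of the surface measure this is the volume of a cone with a spherical base. Its
  slice at height \<open>z\<close> is a disc, bounded by the lateral surface of the cone for \<open>z < t\<close> and by the
  unit sphere for \<open>t < z\<close>.\<close>

lemma sphere_emeasure_open_cap:
  fixes t :: real
  assumes t: "0 < t" "t < 1"
  shows "emeasure sphere_measure {x \<in> S2. t < x $ 3} = ennreal (2 * pi * (1 - t))"
proof -
  define K where "K = {x \<in> ball 0 1 - {0 :: real^3}. x /\<^sub>R norm x \<in> {x \<in> S2. t < x $ 3}}"
  define A where "A z = {p :: complex. (norm p)\<^sup>2 + z\<^sup>2 < 1 \<and> t * sqrt ((norm p)\<^sup>2 + z\<^sup>2) < z}" for z :: real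
  have cap: "{x \<in> S2. t < x $ 3} \<in> sets sphere_measure"
    by (auto simp: sets_restrict_space_iff)
  have K_alt: "K = {x. norm x < 1 \<and> t * norm x < x $ 3}"
    unfolding K_def using t by (auto simp: field_simps divide_simps)
  have K: "K \<in> sets borel" unfolding K_alt by measurable
  have nT: "norm (from_cylinder (z, p)) = sqrt ((norm p)\<^sup>2 + z\<^sup>2)" for z p
    by (simp add: from_cylinder_def norm_vec_def L2_set_def sum_3 cmod_power2)
  have slice: "Pair z -` (from_cylinder -` K) = A z" for z
    using nT by (auto simp: K_alt A_def) (auto simp: from_cylinder_def)
  have TK: "from_cylinder -` K \<in> sets (lborel \<Otimes>\<^sub>M lborel)"
    unfolding lborel_prod using measurable_sets[OF measurable_from_cylinder K] by simp
  have "emeasure lborel K = emeasure (distr lborel borel from_cylinder) K"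
    using lborel_cylindrical by simp
  also have "\<dots> = emeasure (lborel \<Otimes>\<^sub>M lborel) (from_cylinder -` K)"
    using emeasure_distr[OF measurable_from_cylinder K] by (simp add: lborel_prod)
  also have "\<dots> = (\<integral>\<^sup>+ z. emeasure lborel (A z) \<partial>lborel)"
    by (subst lborel.emeasure_pair_measure_alt[OF TK]) (simp add: slice)
  also have "\<dots> = (\<integral>\<^sup>+ z. ennreal (pi * (z\<^sup>2 * (1 / t\<^sup>2 - 1))) * indicator {0..t} z
                      + ennreal (pi * (1 - z\<^sup>2)) * indicator {t..1} z \<partial>lborel)"
  proof (rule nn_integral_cong_AE, rule eventually_mono[OF AE_lborel_singleton[of t]])
    fix z :: real assume zt: "z \<noteq> t"
    have t2: "t\<^sup>2 < 1" using t by (simp add: power_less_one_iff)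
    have area: "emeasure lborel (ball 0 (sqrt r) :: complex set) = ennreal (pi * r)" if "0 \<le> r" for r
      using that by (simp add: emeasure_ball unit_ball_vol_2)
    have second: "t * sqrt (s + z\<^sup>2) < z \<longleftrightarrow> s < z\<^sup>2 * (1 / t\<^sup>2 - 1)" if "0 \<le> z" "0 \<le> s" for s
    proof -
      have "z \<le> t * sqrt (s + z\<^sup>2) \<longleftrightarrow> z\<^sup>2 \<le> (t * sqrt (s + z\<^sup>2))\<^sup>2"
        using that t by (intro power_mono_iff[symmetric]) auto
      then have "t * sqrt (s + z\<^sup>2) < z \<longleftrightarrow> (t * sqrt (s + z\<^sup>2))\<^sup>2 < z\<^sup>2"
        by linarith
      also have "(t * sqrt (s + z\<^sup>2))\<^sup>2 = t\<^sup>2 * (s + z\<^sup>2)"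
        using that by (simp add: power_mult_distrib)
      also have "t\<^sup>2 * (s + z\<^sup>2) < z\<^sup>2 \<longleftrightarrow> s + z\<^sup>2 < z\<^sup>2 / t\<^sup>2"
        using t by (simp add: pos_less_divide_eq mult.commute)
      also have "\<dots> \<longleftrightarrow> s < z\<^sup>2 * (1 / t\<^sup>2 - 1)"
        by (auto simp: right_diff_distrib)
      finally show ?thesis .
    qed
    have "(norm p)\<^sup>2 < r \<longleftrightarrow> norm p < sqrt r" for r and p :: complex
      using real_sqrt_less_iff[of "(norm p)\<^sup>2" r] by simp
    then have ball: "{p :: complex. (norm p)\<^sup>2 < r} = ball 0 (sqrt r)" for r
      by auto
    consider "z < 0" | "0 \<le> z" "z < t" | "t < z" "z \<le> 1" | "1 < z" using zt by linarith
    then show "emeasure lborel (A z) = ennreal (pi * (z\<^sup>2 * (1 / t\<^sup>2 - 1))) * indicator {0..t} z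
                      + ennreal (pi * (1 - z\<^sup>2)) * indicator {t..1} z"
    proof cases
      case 1
      have "\<not> t * sqrt (s + z\<^sup>2) < z" if "0 \<le> s" for s
      proof -
        have "0 \<le> t * sqrt (s + z\<^sup>2)" using t that by (intro mult_nonneg_nonneg) auto
        with 1 show ?thesis by linarith
      qed
      then have "A z = {}" unfolding A_def using zero_le_power2 by blast
      then show ?thesis using 1 t by simp
    next
      case 2
      let ?r = "z\<^sup>2 * (1 / t\<^sup>2 - 1)"
      have "?r + z\<^sup>2 < 1" using 2 t by (simp add: field_simps power_strict_mono)
      then have "(norm p)\<^sup>2 + z\<^sup>2 < 1" if "(norm p)\<^sup>2 < ?r" for p :: complex
        using that by linarith
      then have "A z = {p. (norm p)\<^sup>2 < ?r}"
        unfolding A_def using second[OF 2(1) zero_le_power2] by blast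
      moreover have "0 \<le> ?r" using t t2 by (intro mult_nonneg_nonneg) (auto simp: field_simps)
      ultimately show ?thesis using 2 area ball by simp
    next
      case 3
      have z0: "0 \<le> z" using 3 t by simp
      let ?r = "1 - z\<^sup>2"
      have "t\<^sup>2 \<le> z\<^sup>2" using 3 t by (intro power_mono) auto
      then have "?r \<le> z\<^sup>2 * (1 / t\<^sup>2 - 1)" using t by (simp add: field_simps)
      then have "(norm p)\<^sup>2 < z\<^sup>2 * (1 / t\<^sup>2 - 1)" if "(norm p)\<^sup>2 < ?r" for p :: complex
        using that by linarith
      moreover have "(norm p)\<^sup>2 + z\<^sup>2 < 1 \<longleftrightarrow> (norm p)\<^sup>2 < ?r" for p :: complex
        by linarith
      ultimately have "A z = {p. (norm p)\<^sup>2 < ?r}"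
        unfolding A_def using second[OF z0 zero_le_power2] by blast
      moreover have "0 \<le> ?r" using 3 t by (simp add: power_le_one)
      ultimately show ?thesis using 3 t area ball by simp
    next
      case 4
      then have "1 < z\<^sup>2" by (simp add: one_less_power)
      then have "\<not> s + z\<^sup>2 < 1" if "0 \<le> s" for s
        using that by linarith
      then have "A z = {}" unfolding A_def using zero_le_power2 by blast
      then show ?thesis using 4 t by simp
    qed
  qed
  also have "\<dots> = (\<integral>\<^sup>+ z. ennreal (pi * (z\<^sup>2 * (1 / t\<^sup>2 - 1))) * indicator {0..t} z \<partial>lborel)
                + (\<integral>\<^sup>+ z. ennreal (pi * (1 - z\<^sup>2)) * indicator {t..1} z \<partial>lborel)"
    by (rule nn_integral_add) auto
  also have "(\<integral>\<^sup>+ z. ennreal (pi * (z\<^sup>2 * (1 / t\<^sup>2 - 1))) * indicator {0..t} z \<partial>lborel)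
      = ennreal (pi * (t ^ 3 / 3 * (1 / t\<^sup>2 - 1)) - pi * (0 ^ 3 / 3 * (1 / t\<^sup>2 - 1)))"
  proof (rule nn_integral_FTC_Icc)
    show "((\<lambda>z. pi * (z ^ 3 / 3 * (1 / t\<^sup>2 - 1))) has_real_derivative pi * (z\<^sup>2 * (1 / t\<^sup>2 - 1))) (at z)" for z
      by (auto intro!: derivative_eq_intros)
    have "0 \<le> 1 / t\<^sup>2 - 1" using t by (simp add: power_le_one)
    then show "0 \<le> pi * (z\<^sup>2 * (1 / t\<^sup>2 - 1))" for z by simp
  qed (use t in auto)
  also have "(\<integral>\<^sup>+ z. ennreal (pi * (1 - z\<^sup>2)) * indicator {t..1} z \<partial>lborel)
      = ennreal (pi * (1 - 1 ^ 3 / 3) - pi * (t - t ^ 3 / 3))"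
  proof (rule nn_integral_FTC_Icc)
    show "((\<lambda>z. pi * (z - z ^ 3 / 3)) has_real_derivative pi * (1 - z\<^sup>2)) (at z)" for z
      by (auto intro!: derivative_eq_intros)
    show "0 \<le> pi * (1 - z\<^sup>2)" if "z \<in> {t..1}" for z using that t by (simp add: power_le_one)
  qed (use t in auto)
  also have "ennreal (pi * (t ^ 3 / 3 * (1 / t\<^sup>2 - 1)) - pi * (0 ^ 3 / 3 * (1 / t\<^sup>2 - 1)))
      + ennreal (pi * (1 - 1 ^ 3 / 3) - pi * (t - t ^ 3 / 3)) = ennreal (2 / 3 * pi * (1 - t))"
  proof (subst ennreal_plus[symmetric])
    have "t\<^sup>2 \<le> 1" using t by (simp add: power_le_one)
    then show "0 \<le> pi * (t ^ 3 / 3 * (1 / t\<^sup>2 - 1)) - pi * (0 ^ 3 / 3 * (1 / t\<^sup>2 - 1))"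
      using t by (auto simp: field_simps intro!: mult_nonneg_nonneg)
    have "t * (3 - t\<^sup>2) \<le> 1 * 2"
    proof -
      have "0 \<le> (1 - t)\<^sup>2 * (t + 2)" using t by simp
      then show ?thesis by (simp add: power2_eq_square algebra_simps)
    qed
    then have "0 \<le> pi * ((1 - 1 ^ 3 / 3) - (t - t ^ 3 / 3))"
      by (intro mult_nonneg_nonneg) (auto simp: power2_eq_square power3_eq_cube algebra_simps)
    then show "0 \<le> pi * (1 - 1 ^ 3 / 3) - pi * (t - t ^ 3 / 3)" by (simp add: algebra_simps)
    have cubic: "t ^ 3 / 3 * (1 / t\<^sup>2 - 1) = t / 3 - t ^ 3 / 3"
      using t by (simp add: field_simps power2_eq_square power3_eq_cube)
    show "ennreal (pi * (t ^ 3 / 3 * (1 / t\<^sup>2 - 1)) - pi * (0 ^ 3 / 3 * (1 / t\<^sup>2 - 1))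
        + (pi * (1 - 1 ^ 3 / 3) - pi * (t - t ^ 3 / 3))) = ennreal (2 / 3 * pi * (1 - t))"
      unfolding cubic by (intro arg_cong[where f = ennreal]) (simp add: algebra_simps)
  qed
  finally have "emeasure lborel K = ennreal (2 / 3 * pi * (1 - t))" .
  then show ?thesis
    unfolding emeasure_sphere_measure[OF cap] K_def[symmetric]
    using t by (simp flip: ennreal_mult' ennreal_numeral)
qed

lemma measurable_third_coord [measurable]: "(\<lambda>x. x $ 3) \<in> borel_measurable sphere_measure"
proof -
  have "(\<lambda>x :: real^3. x $ 3) \<in> borel_measurable (restrict_space borel S2)"
    by (rule measurable_restrict_space1) measurable
  then show ?thesis by (simp cong: measurable_cong_sets)
qed

lemma orthogonal_reflection: "orthogonal_transformation (\<lambda>x :: real^3. - x)"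
  by (simp add: orthogonal_transformation_def linear_iff)

text \<open>The height is uniformly distributed on the sphere (Archimedes). Two measures on the line agree if
  they agree on all rays \<open>{t<..}\<close>, whose preimages are the caps.\<close>

lemma archimedes_hat_box:
  "distr sphere_measure borel (\<lambda>x. x $ 3) = density lborel (\<lambda>t. ennreal (2 * pi * indicator {-1..1} t))"
    (is "?M = ?N")
proof -
  define F where "F t = measure sphere_measure {x \<in> S2. t < x $ 3}" for t
  have sets: "{x \<in> S2. P (x $ 3)} \<in> sets sphere_measure" if "{t. P t} \<in> sets borel" for P
  proof -
    have "(\<lambda>x. x $ 3) -` {t. P t} \<inter> space sphere_measure \<in> sets sphere_measure"
      using measurable_third_coord that by (rule measurable_sets)
    then show ?thesis by (simp add: vimage_def Int_def conj_commute)
  qed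
  have total: "measure sphere_measure S2 = 4 * pi"
    by (simp add: measure_def emeasure_sphere_measure_S2)
  have F_pos: "F t = 2 * pi * (1 - t)" if "0 < t" "t < 1" for t
    using sphere_emeasure_open_cap[OF that] that by (simp add: F_def measure_def)
  \<comment> \<open>Reflection in the origin and additivity determine the caps of negative height up to the
    mass of circles of latitude, which monotonicity in the height squeezes to zero.\<close>
  have refl: "measure sphere_measure {x \<in> S2. x $ 3 < t} = F (- t)" for t
  proof -
    have "{x \<in> S2. x $ 3 < t} \<in> sets sphere_measure" by (rule sets) auto
    from sphere_measure_rotation_invariant[OF orthogonal_reflection this]
    have "emeasure sphere_measure (uminus ` {x \<in> S2. x $ 3 < t}) = emeasure sphere_measure {x \<in> S2. x $ 3 < t}" .
    moreover have "uminus ` {x \<in> S2. x $ 3 < t} = {x \<in> S2. - t < x $ 3}"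
      by (auto simp: image_iff intro!: exI[of _ "- _"])
    ultimately show ?thesis by (simp add: F_def measure_def)
  qed
  have compl: "F t = 4 * pi - measure sphere_measure {x \<in> S2. x $ 3 \<le> t}" for t
  proof -
    have "measure sphere_measure (space sphere_measure - {x \<in> S2. x $ 3 \<le> t})
        = measure sphere_measure (space sphere_measure) - measure sphere_measure {x \<in> S2. x $ 3 \<le> t}"
      by (rule sphere.finite_measure_compl) (rule sets, auto)
    moreover have "space sphere_measure - {x \<in> S2. x $ 3 \<le> t} = {x \<in> S2. t < x $ 3}"
      by auto
    ultimately show ?thesis by (simp add: F_def total)
  qed
  have mono: "measure sphere_measure {x \<in> S2. P (x $ 3)} \<le> measure sphere_measure {x \<in> S2. Q (x $ 3)}"
    if "{t. Q t} \<in> sets borel" "\<And>t. P t \<Longrightarrow> Q t" for P Q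
    by (rule sphere.finite_measure_mono[OF _ sets[OF that(1)]]) (use that(2) in auto)
  have F_nonpos: "F t = 2 * pi * (1 - t)" if t: "-1 < t" "t \<le> 0" for t
  proof (rule antisym)
    show "F t \<le> 2 * pi * (1 - t)"
    proof (rule field_le_epsilon)
      fix e :: real assume "0 < e"
      define s where "s = max ((t - 1) / 2) (t - e / (2 * pi))"
      have s: "-1 < s" "s < t" "s < 0" "2 * pi * (t - s) \<le> e"
      proof -
        have e': "0 < e / (2 * pi)" using \<open>0 < e\<close> by simp
        have "-1 < (t - 1) / 2" using t by (simp add: field_simps)
        then show "-1 < s" "s < t" "s < 0" using t e' by (auto simp: s_def less_max_iff_disj)
        have "t - s \<le> e / (2 * pi)" by (simp add: s_def)
        then show "2 * pi * (t - s) \<le> e" by (simp add: field_simps)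
      qed
      have "measure sphere_measure {x \<in> S2. x $ 3 < s} \<le> measure sphere_measure {x \<in> S2. x $ 3 \<le> t}"
        by (rule mono) (use s in auto)
      then have "F t \<le> 4 * pi - F (- s)" unfolding compl[of t] refl by simp
      also have "\<dots> = 2 * pi * (1 - t) + 2 * pi * (t - s)"
        using F_pos[of "- s"] s by (simp add: algebra_simps)
      finally show "F t \<le> 2 * pi * (1 - t) + e" using s by simp
    qed
    show "2 * pi * (1 - t) \<le> F t"
    proof (cases "t = 0")
      case True
      show ?thesis
      proof (rule field_le_epsilon)
        fix e :: real assume "0 < e"
        define s where "s = min (1 / 2) (e / (2 * pi))"
        have s: "0 < s" "s < 1" "2 * pi * s \<le> e"
          using \<open>0 < e\<close> by (auto simp: s_def field_simps min_def)
        have "F s \<le> F t" unfolding F_def by (rule mono) (use s True in auto)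
        then show "2 * pi * (1 - t) \<le> F t + e"
          using F_pos[of s] s True by (simp add: algebra_simps)
      qed
    next
      case False
      show ?thesis
      proof (rule field_le_epsilon)
        fix e :: real assume "0 < e"
        define s where "s = min (t / 2) (t + e / (2 * pi))"
        have s: "t < s" "s < 0" "2 * pi * (s - t) \<le> e"
          using t False \<open>0 < e\<close> by (auto simp: s_def field_simps min_def)
        have "measure sphere_measure {x \<in> S2. x $ 3 \<le> t} \<le> measure sphere_measure {x \<in> S2. x $ 3 < s}"
          by (rule mono) (use s in auto)
        then have "4 * pi - F (- s) \<le> F t" unfolding compl[of t] refl by simp
        moreover have "4 * pi - F (- s) = 2 * pi * (1 - t) - 2 * pi * (s - t)"
          using F_pos[of "- s"] s t by (simp add: algebra_simps)
        ultimately show "2 * pi * (1 - t) \<le> F t + e" using s by simp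
      qed
    qed
  qed
  have F_ge: "F t = 0" if "1 \<le> t" for t
  proof -
    have empty: "{x \<in> S2. t < x $ 3} = {}" using sphere_third_coord that by fastforce
    show ?thesis unfolding F_def empty by (rule measure_empty)
  qed
  have F_le: "F t = 4 * pi" if "t < -1" for t
  proof -
    have full: "{x \<in> S2. t < x $ 3} = S2" using sphere_third_coord that by fastforce
    show ?thesis unfolding F_def full by (rule total)
  qed
  have F_m1: "F (-1) = 4 * pi"
  proof (rule antisym)
    show "F (-1) \<le> 4 * pi"
      unfolding F_def total[symmetric] using sets.top[of sphere_measure]
      by (intro sphere.finite_measure_mono) (auto simp only: space_sphere_measure)
    show "4 * pi \<le> F (-1)"
    proof (rule field_le_epsilon)
      fix e :: real assume "0 < e"
      define s where "s = min 0 (-1 + e / (2 * pi))"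
      have s: "-1 < s" "s \<le> 0" "2 * pi * (s + 1) \<le> e"
        using \<open>0 < e\<close> by (auto simp: s_def field_simps min_def)
      have "F s \<le> F (-1)" unfolding F_def by (rule mono) (use s in auto)
      then show "4 * pi \<le> F (-1) + e"
        using F_nonpos[of s] s by (simp add: algebra_simps)
    qed
  qed
  have F: "F t = 2 * pi * (1 - max (-1) (min 1 t))" for t
    using F_pos[of t] F_nonpos[of t] F_ge[of t] F_le[of t] F_m1
    by (cases "t < -1"; cases "t = -1"; cases "t \<le> 0"; cases "t < 1") auto
  have EM: "emeasure ?M {t<..} = ennreal (F t)" for t
  proof -
    have "emeasure ?M {t<..} = emeasure sphere_measure ((\<lambda>x. x $ 3) -` {t<..} \<inter> space sphere_measure)"
      by (rule emeasure_distr) auto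
    also have "(\<lambda>x. x $ 3) -` {t<..} \<inter> space sphere_measure = {x \<in> S2. t < x $ 3}" by auto
    finally show ?thesis by (simp add: F_def sphere.emeasure_eq_measure)
  qed
  show ?thesis
  proof (rule measure_eqI_lessThan)
    fix t :: real
    show "emeasure ?M {t<..} < \<infinity>" by (simp add: EM)
    have "emeasure ?N {t<..} = (\<integral>\<^sup>+ x. ennreal (2 * pi * indicator {-1..1} x) * indicator {t<..} x \<partial>lborel)"
      by (rule emeasure_density) auto
    also have "\<dots> = (\<integral>\<^sup>+ x. ennreal (2 * pi) * indicator ({-1..1} \<inter> {t<..}) x \<partial>lborel)"
      by (rule nn_integral_cong) (auto split: split_indicator)
    also have "\<dots> = ennreal (2 * pi) * emeasure lborel ({-1..1} \<inter> {t<..})"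
      by (rule nn_integral_cmult_indicator) auto
    also have "{-1..1} \<inter> {t<..} = (if t < -1 then {-1..1} else {t<..1})" by auto
    also have "emeasure lborel \<dots> = ennreal (1 - max (-1) (min 1 t))"
      by (cases "t \<le> 1") auto
    also have "ennreal (2 * pi) * \<dots> = ennreal (F t)"
      unfolding F by (rule ennreal_mult'[symmetric]) simp
    finally show "emeasure ?M {t<..} = emeasure ?N {t<..}" by (simp add: EM)
  qed auto
qed

lemma sphere_integrable_zonal_iff:
  fixes \<psi> :: "real \<Rightarrow> 'b :: {banach, second_countable_topology}"
  assumes [measurable]: "\<psi> \<in> borel_measurable borel"
  shows "integrable sphere_measure (\<lambda>x. \<psi> (x $ 3)) \<longleftrightarrow> set_integrable lborel {-1..1} \<psi>"
proof -
  have "integrable sphere_measure (\<lambda>x. \<psi> (x $ 3))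
      \<longleftrightarrow> integrable (distr sphere_measure borel (\<lambda>x. x $ 3)) \<psi>"
    by (rule integrable_distr_eq[symmetric]) auto
  also have "\<dots> \<longleftrightarrow> integrable lborel (\<lambda>t. (2 * pi * indicator {-1..1} t) *\<^sub>R \<psi> t)"
    unfolding archimedes_hat_box by (rule integrable_density) auto
  also have "\<dots> \<longleftrightarrow> integrable lborel (\<lambda>t. (2 * pi) *\<^sub>R (indicator {-1..1} t *\<^sub>R \<psi> t))"
    by (simp only: scaleR_scaleR)
  also have "\<dots> \<longleftrightarrow> set_integrable lborel {-1..1} \<psi>"
    unfolding set_integrable_def
  proof
    assume "integrable lborel (\<lambda>t. (2 * pi) *\<^sub>R (indicator {-1..1} t *\<^sub>R \<psi> t))"
    from integrable_scaleR_right[OF this, of "1 / (2 * pi)"]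
    show "integrable lborel (\<lambda>t. indicator {-1..1} t *\<^sub>R \<psi> t)" by simp
  qed (rule integrable_scaleR_right)
  finally show ?thesis .
qed

lemma sphere_integral_zonal:
  fixes \<psi> :: "real \<Rightarrow> 'b :: {banach, second_countable_topology}"
  assumes [measurable]: "\<psi> \<in> borel_measurable borel"
  shows "(LINT x|sphere_measure. \<psi> (x $ 3)) = (2 * pi) *\<^sub>R (LINT t:{-1..1}|lborel. \<psi> t)"
proof -
  have "(LINT x|sphere_measure. \<psi> (x $ 3)) = (LINT t|distr sphere_measure borel (\<lambda>x. x $ 3). \<psi> t)"
    by (rule integral_distr[symmetric]) auto
  also have "\<dots> = (LINT t|lborel. (2 * pi * indicator {-1..1} t) *\<^sub>R \<psi> t)"
    unfolding archimedes_hat_box by (rule integral_density) auto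
  also have "\<dots> = (LINT t|lborel. (2 * pi) *\<^sub>R (indicator {-1..1} t *\<^sub>R \<psi> t))"
    by (simp only: scaleR_scaleR)
  also have "\<dots> = (2 * pi) *\<^sub>R (LINT t:{-1..1}|lborel. \<psi> t)"
    unfolding set_lebesgue_integral_def by (rule integral_scaleR_right)
  finally show ?thesis .
qed

lemma set_integrable_poly: "set_integrable lborel {a..b} (poly (p :: real poly))"
  by (intro borel_integrable_atLeastAtMost' continuous_intros)

lemma set_integral_poly: "(LINT t:{a..b}|lborel. poly p t) = integral {a..b} (poly (p :: real poly))"
  by (rule set_borel_integral_eq_integral(2)[OF set_integrable_poly])

lemma set_integral_Complex_poly:
  "(LINT t:{a..b}|lborel. Complex (poly p t) (poly q t))
     = Complex (integral {a..b} (poly p)) (integral {a..b} (poly q))"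
proof -
  have "(LINT t:{a..b}|lborel. Complex (poly p t) (poly q t))
      = (LINT t:{a..b}|lborel. complex_of_real (poly p t) + \<i> * complex_of_real (poly q t))"
    by (simp add: Complex_eq)
  also have "\<dots> = (LINT t:{a..b}|lborel. complex_of_real (poly p t))
      + (LINT t:{a..b}|lborel. \<i> * complex_of_real (poly q t))"
    by (intro set_integral_add(2) borel_integrable_atLeastAtMost' continuous_intros)
  also have "\<dots> = Complex (integral {a..b} (poly p)) (integral {a..b} (poly q))"
    by (simp add: set_integral_complex_of_real set_integral_poly Complex_eq)
  finally show ?thesis .
qed

lemma north_pole_in_S2: "north_pole \<in> S2"
  unfolding sphere_coords by (simp add: north_pole_def)

lemma inner_north_pole: "x \<bullet> north_pole = x $ 3" "north_pole \<bullet> x = x $ 3"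
  by (simp_all add: north_pole_def inner_vec_def sum_3)

lemma rotation_to_point:
  assumes "x \<in> S2"
  obtains R where "orthogonal_transformation R" "R north_pole = x" "\<And>y. x \<bullet> R y = y $ 3"
proof -
  have "norm north_pole = 1" "norm x = 1" using north_pole_in_S2 assms by simp_all
  then obtain R where R: "orthogonal_transformation R" and Rx: "R north_pole = x"
    by (rule orthogonal_transformation_exists_1)
  have "x \<bullet> R y = y $ 3" for y
    using R unfolding Rx[symmetric] by (simp add: orthogonal_transformation_def inner_north_pole)
  with R Rx show ?thesis by (rule that)
qed

text \<open>In spherical coordinates \<open>horiz x\<close> is \<open>sin \<theta> exp (\<i> \<phi>)\<close>, so its powers carry the dependence on
  the azimuth.\<close>

definition horiz :: "real^3 \<Rightarrow> complex" where
  "horiz x = Complex (x $ 1) (x $ 2)"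

lemma horiz_alt: "horiz x = of_real (x $ 1) + \<i> * of_real (x $ 2)"
  by (simp add: horiz_def complex_eq_iff)

lemma measurable_horiz [measurable]: "horiz \<in> borel_measurable borel"
  unfolding horiz_alt[abs_def] by measurable

lemma measurable_sphere_borel: "f \<in> borel_measurable borel \<Longrightarrow> f \<in> borel_measurable sphere_measure"
  by (simp add: measurable_restrict_space1 cong: measurable_cong_sets)

lemma measurable_ident_sphere [measurable]: "(\<lambda>x. x) \<in> borel_measurable sphere_measure"
  by (rule measurable_sphere_borel) measurable

lemma measurable_cnj [measurable]: "cnj \<in> borel_measurable borel"
  by (intro borel_measurable_continuous_onI continuous_intros)

lemma horiz_mult_cnj: "x \<in> S2 \<Longrightarrow> horiz x * cnj (horiz x) = of_real (1 - (x $ 3)\<^sup>2)"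
proof -
  assume "x \<in> S2"
  then have "(x $ 1)\<^sup>2 + (x $ 2)\<^sup>2 = 1 - (x $ 3)\<^sup>2" unfolding sphere_coords by simp
  then show ?thesis by (simp only: complex_mult_cnj horiz_def complex.sel)
qed

lemma cmod_horiz: "x \<in> S2 \<Longrightarrow> cmod (horiz x) = sqrt (1 - (x $ 3)\<^sup>2)"
  unfolding sphere_coords by (simp add: horiz_def cmod_def)

lemma cmod_horiz_le: "x \<in> S2 \<Longrightarrow> cmod (horiz x) \<le> 1"
  by (simp add: cmod_horiz)

lemma measurable_poly [measurable]: "poly p \<in> borel_measurable (borel :: real measure)" for p :: "real poly"
  by (intro borel_measurable_continuous_onI continuous_intros)

definition rotate_azimuth :: "real \<Rightarrow> real^3 \<Rightarrow> real^3" where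
  "rotate_azimuth \<alpha> x = vector [cos \<alpha> * x $ 1 - sin \<alpha> * x $ 2, sin \<alpha> * x $ 1 + cos \<alpha> * x $ 2, x $ 3]"

lemma horiz_rotate_azimuth: "horiz (rotate_azimuth \<alpha> x) = cis \<alpha> * horiz x"
  by (simp add: horiz_def rotate_azimuth_def complex_eq_iff)

lemma orthogonal_rotate_azimuth: "orthogonal_transformation (rotate_azimuth \<alpha>)"
proof -
  have "rotate_azimuth \<alpha> v \<bullet> rotate_azimuth \<alpha> w = v \<bullet> w" for v w
  proof -
    have "rotate_azimuth \<alpha> v \<bullet> rotate_azimuth \<alpha> w
       = ((cos \<alpha>)\<^sup>2 + (sin \<alpha>)\<^sup>2) * (v $ 1 * w $ 1 + v $ 2 * w $ 2) + v $ 3 * w $ 3"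
      unfolding power2_eq_square
      by (simp add: inner_vec_def sum_3 rotate_azimuth_def algebra_simps del: sin_cos_squared_add sin_cos_squared_add2 sin_cos_squared_add3)
    then show ?thesis by (simp add: inner_vec_def sum_3)
  qed
  moreover have "linear (rotate_azimuth \<alpha>)"
    by (rule linearI) (auto simp: rotate_azimuth_def vec_eq_iff forall_3 algebra_simps)
  ultimately show ?thesis by (simp add: orthogonal_transformation_def)
qed

text \<open>For \<open>a \<noteq> b\<close>, rotating the azimuth by \<open>\<pi> / (a - b)\<close> changes the sign of the integrand but not the
  integral. For \<open>a = b\<close> the integrand depends on the height only.\<close>

lemma sphere_integral_monomial:
  fixes \<psi> :: "real \<Rightarrow> complex"
  assumes [measurable]: "\<psi> \<in> borel_measurable borel"
  shows "(LINT x|sphere_measure. horiz x ^ a * cnj (horiz x) ^ b * \<psi> (x $ 3))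
    = (if a = b then 2 * pi * (LINT t:{-1..1}|lborel. of_real ((1 - t\<^sup>2) ^ a) * \<psi> t) else 0)"
proof (cases "a = b")
  case True
  have "(LINT x|sphere_measure. horiz x ^ a * cnj (horiz x) ^ b * \<psi> (x $ 3))
      = (LINT x|sphere_measure. of_real ((1 - (x $ 3)\<^sup>2) ^ a) * \<psi> (x $ 3))"
  proof (rule Bochner_Integration.integral_cong[OF refl])
    fix x assume "x \<in> space sphere_measure"
    then have x: "x \<in> S2" by simp
    show "horiz x ^ a * cnj (horiz x) ^ b * \<psi> (x $ 3) = of_real ((1 - (x $ 3)\<^sup>2) ^ a) * \<psi> (x $ 3)"
      using True by (simp only: power_mult_distrib[symmetric] horiz_mult_cnj[OF x] of_real_power)
  qed
  also have "\<dots> = (2 * pi) *\<^sub>R (LINT t:{-1..1}|lborel. of_real ((1 - t\<^sup>2) ^ a) * \<psi> t)"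
    by (rule sphere_integral_zonal) measurable
  finally show ?thesis using True by (simp add: scaleR_conv_of_real)
next
  case False
  let ?f = "\<lambda>x. horiz x ^ a * cnj (horiz x) ^ b * \<psi> (x $ 3)"
  define \<alpha> where "\<alpha> = pi / (real a - real b)"
  have c: "cis \<alpha> ^ a * cnj (cis \<alpha>) ^ b = -1"
  proof -
    have "cis \<alpha> ^ a * cnj (cis \<alpha>) ^ b = cis (real a * \<alpha> + real b * (- \<alpha>))"
      by (simp only: Complex.DeMoivre cis_cnj cis_mult)
    also have "real a * \<alpha> + real b * (- \<alpha>) = (real a - real b) * \<alpha>" by (simp add: algebra_simps)
    also have "\<dots> = pi" using False by (simp add: \<alpha>_def)
    finally show ?thesis by simp
  qed
  have "?f (rotate_azimuth \<alpha> x) = - ?f x" for x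
  proof -
    have "?f (rotate_azimuth \<alpha> x) = (cis \<alpha> ^ a * cnj (cis \<alpha>) ^ b) * ?f x"
      by (simp only: horiz_rotate_azimuth complex_cnj_mult power_mult_distrib)
         (simp add: rotate_azimuth_def)
    then show ?thesis unfolding c by simp
  qed
  moreover have "(LINT x|sphere_measure. ?f (rotate_azimuth \<alpha> x)) = (LINT x|sphere_measure. ?f x)"
    by (rule sphere_integral_orthogonal[OF orthogonal_rotate_azimuth]) measurable
  ultimately have "- (LINT x|sphere_measure. ?f x) = (LINT x|sphere_measure. ?f x)"
    by simp
  then show ?thesis using False by (simp add: neg_equal_zero)
qed

section \<open>Polynomial functions on the sphere\<close>

text \<open>The functions that agree on the sphere with a polynomial of total degree at most \<open>d\<close> in the
  coordinates \<open>w = x\<^sub>1 + \<i> x\<^sub>2\<close>, \<open>cnj w\<close> and \<open>x\<^sub>3\<close>. In these coordinates the average of a monomial over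
  the circles of latitude is explicit.\<close>

inductive sphere_poly :: "nat \<Rightarrow> (real^3 \<Rightarrow> complex) \<Rightarrow> bool" for d where
  monomial: "a + b + c \<le> d \<Longrightarrow> sphere_poly d (\<lambda>x. k * horiz x ^ a * cnj (horiz x) ^ b * of_real (x $ 3) ^ c)"
| add: "sphere_poly d f \<Longrightarrow> sphere_poly d g \<Longrightarrow> sphere_poly d (\<lambda>x. f x + g x)"
| cong: "sphere_poly d f \<Longrightarrow> (\<And>x. x \<in> S2 \<Longrightarrow> f x = g x) \<Longrightarrow> sphere_poly d g"

lemma sphere_poly_mono: "sphere_poly d f \<Longrightarrow> d \<le> e \<Longrightarrow> sphere_poly e f"
  by (induction rule: sphere_poly.induct) (auto intro: sphere_poly.intros)

lemma sphere_poly_const: "sphere_poly d (\<lambda>x. k)"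
  using sphere_poly.monomial[of 0 0 0 d k] by simp

lemma sphere_poly_cmult: "sphere_poly d f \<Longrightarrow> sphere_poly d (\<lambda>x. k * f x)"
proof (induction rule: sphere_poly.induct)
  case (monomial a b c k')
  then show ?case using sphere_poly.monomial[of a b c d "k * k'"] by (simp add: mult_ac)
next
  case (add f g)
  then show ?case using sphere_poly.add[of d "\<lambda>x. k * f x" "\<lambda>x. k * g x"] by (simp add: distrib_left)
next
  case (cong f g)
  then show ?case by (auto intro: sphere_poly.cong)
qed

lemma sphere_poly_cnj: "sphere_poly d f \<Longrightarrow> sphere_poly d (\<lambda>x. cnj (f x))"
proof (induction rule: sphere_poly.induct)
  case (monomial a b c k)
  then show ?case using sphere_poly.monomial[of b a c d "cnj k"] by (simp add: mult_ac)
next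
  case (add f g)
  then show ?case using sphere_poly.add[of d "\<lambda>x. cnj (f x)" "\<lambda>x. cnj (g x)"] by simp
next
  case (cong f g)
  then show ?case by (auto intro: sphere_poly.cong)
qed

lemma sphere_poly_sum:
  assumes "\<And>i. i \<in> I \<Longrightarrow> sphere_poly d (f i)"
  shows "sphere_poly d (\<lambda>x. \<Sum>i\<in>I. f i x)"
  using assms by (induction I rule: infinite_finite_induct) (auto intro: sphere_poly_const sphere_poly.add)

lemma sphere_poly_of_poly:
  "degree u \<le> d \<Longrightarrow> sphere_poly d (\<lambda>x. of_real (poly u (x $ 3)))"
proof -
  assume u: "degree u \<le> d"
  have "sphere_poly d (\<lambda>x. \<Sum>i\<le>degree u. of_real (coeff u i) * horiz x ^ 0 * cnj (horiz x) ^ 0 * of_real (x $ 3) ^ i)"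
    by (rule sphere_poly_sum, rule sphere_poly.monomial) (use u in auto)
  then show ?thesis by (simp add: poly_altdef)
qed

definition complex_linear_form :: "(real^3 \<Rightarrow> complex) \<Rightarrow> bool" where
  "complex_linear_form f \<longleftrightarrow>
     (\<exists>p q r. \<forall>x. f x = p * of_real (x $ 1) + q * of_real (x $ 2) + r * of_real (x $ 3))"

lemma sphere_poly_mult_linear:
  assumes "complex_linear_form l" "sphere_poly d f"
  shows "sphere_poly (Suc d) (\<lambda>x. l x * f x)"
  using assms(2)
proof (induction rule: sphere_poly.induct)
  case (monomial a b c k)
  obtain p q r where l: "\<And>x. l x = p * of_real (x $ 1) + q * of_real (x $ 2) + r * of_real (x $ 3)"
    using assms(1) unfolding complex_linear_form_def by blast
  define u v where "u = (p - \<i> * q) / 2" and "v = (p + \<i> * q) / 2"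
  have l': "l x = u * horiz x + v * cnj (horiz x) + r * of_real (x $ 3)" for x
    unfolding l horiz_alt u_def v_def by (simp add: field_simps)
  have "sphere_poly (Suc d) (\<lambda>x. (k * u) * horiz x ^ Suc a * cnj (horiz x) ^ b * of_real (x $ 3) ^ c
      + (k * v) * horiz x ^ a * cnj (horiz x) ^ Suc b * of_real (x $ 3) ^ c
      + (k * r) * horiz x ^ a * cnj (horiz x) ^ b * of_real (x $ 3) ^ Suc c)"
    by (intro sphere_poly.add sphere_poly.monomial) (use monomial in auto)
  then show ?case
    by (rule sphere_poly.cong) (simp add: l' algebra_simps)
next
  case (add f g)
  then show ?case using sphere_poly.add[of "Suc d" "\<lambda>x. l x * f x" "\<lambda>x. l x * g x"] by (simp add: distrib_left)
next
  case (cong f g)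
  then show ?case by (auto intro: sphere_poly.cong)
qed

lemma sphere_poly_mult_linear_power:
  assumes "complex_linear_form l" "sphere_poly d f"
  shows "sphere_poly (n + d) (\<lambda>x. l x ^ n * f x)"
  by (induction n) (use assms sphere_poly_mult_linear[OF assms(1)] in \<open>auto simp: mult.assoc\<close>)

text \<open>An orthogonal map turns the three coordinates into linear forms, and multiplication by a linear
  form raises the degree by at most one.\<close>

lemma sphere_poly_orthogonal:
  assumes R: "orthogonal_transformation R" and "sphere_poly d f"
  shows "sphere_poly d (\<lambda>x. f (R x))"
  using assms(2)
proof (induction rule: sphere_poly.induct)
  case (monomial a b c k)
  have lin: "linear R" using R by (rule orthogonal_transformation_linear)
  have R_comp: "R x $ i = matrix R $ i $ 1 * x $ 1 + matrix R $ i $ 2 * x $ 2 + matrix R $ i $ 3 * x $ 3" for x i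
    using fun_cong[OF matrix_vector_mul(2)[OF lin], of x]
    by (auto simp: matrix_vector_mult_def sum_3 vec_eq_iff)
  have "complex_linear_form (\<lambda>x. of_real (R x $ i))" for i
    unfolding complex_linear_form_def by (subst R_comp) auto
  then have lf3: "complex_linear_form (\<lambda>x. of_real (R x $ 3))" .
  have lf1: "complex_linear_form (\<lambda>x. horiz (R x))"
    unfolding complex_linear_form_def horiz_alt
    by (subst (1 2) R_comp)
       (rule exI[of _ "of_real (matrix R $ 1 $ 1) + \<i> * of_real (matrix R $ 2 $ 1)"],
        rule exI[of _ "of_real (matrix R $ 1 $ 2) + \<i> * of_real (matrix R $ 2 $ 2)"],
        rule exI[of _ "of_real (matrix R $ 1 $ 3) + \<i> * of_real (matrix R $ 2 $ 3)"],
        simp add: algebra_simps)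
  have lf2: "complex_linear_form (\<lambda>x. cnj (horiz (R x)))"
  proof -
    obtain p q r where l: "\<And>x. horiz (R x) = p * of_real (x $ 1) + q * of_real (x $ 2) + r * of_real (x $ 3)"
      using lf1 unfolding complex_linear_form_def by blast
    show ?thesis unfolding complex_linear_form_def l
      by (rule exI[of _ "cnj p"], rule exI[of _ "cnj q"], rule exI[of _ "cnj r"]) simp
  qed
  have "sphere_poly (a + (b + (c + 0))) (\<lambda>x. horiz (R x) ^ a * (cnj (horiz (R x)) ^ b * (of_real (R x $ 3) ^ c * k)))"
    by (intro sphere_poly_mult_linear_power lf1 lf2 lf3 sphere_poly_const)
  from sphere_poly_mono[OF this, of d] monomial show ?case
    by (simp add: mult_ac add_ac)
next
  case (add f g)
  from add.IH show ?case by (rule sphere_poly.add)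
next
  case (cong f g)
  have "f (R x) = g (R x)" if "x \<in> S2" for x
    using cong(2) that orthogonal_transformation_norm[OF R] by simp
  with cong(3) show ?case by (rule sphere_poly.cong)
qed

lemma sphere_poly_measurable: "sphere_poly d f \<Longrightarrow> f \<in> borel_measurable sphere_measure"
proof (induction rule: sphere_poly.induct)
  case (cong f g)
  then show ?case using measurable_cong[of sphere_measure f g borel] by simp
qed auto

lemma sphere_poly_bounded: "sphere_poly d f \<Longrightarrow> \<exists>B. \<forall>x\<in>S2. cmod (f x) \<le> B"
proof (induction rule: sphere_poly.induct)
  case (monomial a b c k)
  have "cmod (k * horiz x ^ a * cnj (horiz x) ^ b * of_real (x $ 3) ^ c) \<le> cmod k * 1 * 1 * 1" if "x \<in> S2" for x
    unfolding norm_mult norm_power complex_mod_cnj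
    using cmod_horiz_le[OF that] sphere_third_coord[OF that]
    by (intro mult_mono power_le_one mult_nonneg_nonneg zero_le_power) auto
  then show ?case by blast
next
  case (add f g)
  then obtain B C where "\<forall>x\<in>S2. cmod (f x) \<le> B" "\<forall>x\<in>S2. cmod (g x) \<le> C" by blast
  then have "\<forall>x\<in>S2. cmod (f x + g x) \<le> B + C"
    by (meson add_mono norm_triangle_le)
  then show ?case by blast
next
  case (cong f g)
  then show ?case by metis
qed

lemma sphere_poly_mult_integrable:
  assumes f: "sphere_poly d f" and g: "integrable sphere_measure g"
  shows "integrable sphere_measure (\<lambda>x. f x * g x)"
proof -
  obtain B where B: "\<And>x. x \<in> S2 \<Longrightarrow> cmod (f x) \<le> B" using sphere_poly_bounded[OF f] by blast
  note [measurable] = sphere_poly_measurable[OF f] borel_measurable_integrable[OF g]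
  have "integrable sphere_measure (\<lambda>x. B * cmod (g x))" using g by auto
  then show ?thesis
  proof (rule Bochner_Integration.integrable_bound)
    show "AE x in sphere_measure. norm (f x * g x) \<le> norm (B * cmod (g x))"
    proof (rule AE_I2)
      fix x assume "x \<in> space sphere_measure"
      then have "cmod (f x) \<le> B" using B by simp
      moreover from this have "0 \<le> B" using norm_ge_zero order_trans by blast
      ultimately show "norm (f x * g x) \<le> norm (B * cmod (g x))"
        by (simp add: norm_mult mult_right_mono)
    qed
  qed measurable
qed

lemma sphere_poly_integrable: "sphere_poly d f \<Longrightarrow> integrable sphere_measure f"
  using sphere_poly_mult_integrable[of d f "\<lambda>_. 1"] by simp

text \<open>Integration against a function of the height sees only the average of \<open>f\<close> over the circles of
  latitude. For a monomial this average is zero or \<open>(1 - t\<^sup>2) ^ a * t ^ c\<close>, so in general it is a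
  polynomial of degree at most \<open>d\<close>, with real part \<open>p\<close> and imaginary part \<open>q\<close>. At \<open>t = 1\<close> the circle
  shrinks to the pole.\<close>

lemma sphere_poly_zonal_average:
  assumes "sphere_poly d f"
  shows "\<exists>p q :: real poly. degree p \<le> d \<and> degree q \<le> d \<and> f north_pole = Complex (poly p 1) (poly q 1)
    \<and> (\<forall>\<psi>. \<psi> \<in> borel_measurable borel \<longrightarrow> set_integrable lborel {-1..1} \<psi> \<longrightarrow>
         (LINT x|sphere_measure. f x * \<psi> (x $ 3))
           = 2 * pi * (LINT t:{-1..1}|lborel. Complex (poly p t) (poly q t) * \<psi> t))"
  using assms
proof (induction rule: sphere_poly.induct)
  case (monomial a b c k)
  let ?f = "\<lambda>x. k * horiz x ^ a * cnj (horiz x) ^ b * of_real (x $ 3) ^ c"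
  have pole: "horiz north_pole = 0" "north_pole $ 3 = 1"
    by (simp_all add: north_pole_def horiz_def complex_eq_iff)
  have int: "(LINT x|sphere_measure. ?f x * \<psi> (x $ 3))
      = (if a = b then 2 * pi * (LINT t:{-1..1}|lborel. of_real ((1 - t\<^sup>2) ^ a) * (k * of_real t ^ c * \<psi> t)) else 0)"
    if [measurable]: "\<psi> \<in> borel_measurable borel" for \<psi>
    by (subst sphere_integral_monomial[symmetric]) (auto simp: mult_ac intro!: Bochner_Integration.integral_cong)
  show ?case
  proof (cases "a = b")
    case True
    let ?p = "\<lambda>s. smult s ([:1, 0, -1:] ^ a * monom 1 c) :: real poly"
    have deg: "degree (?p s) \<le> d" for s
    proof -
      have "degree (?p s) \<le> degree ([:1, 0, -1 :: real:] ^ a * monom 1 c)" by (rule degree_smult_le)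
      also have "\<dots> \<le> degree ([:1, 0, -1 :: real:] ^ a) + degree (monom 1 c :: real poly)" by (rule degree_mult_le)
      also have "\<dots> \<le> d" using monomial True by (simp add: degree_power_eq degree_monom_eq)
      finally show ?thesis .
    qed
    have e: "of_real ((1 - t\<^sup>2) ^ a) * (k * of_real t ^ c * z) = Complex (poly (?p (Re k)) t) (poly (?p (Im k)) t) * z" for t z
    proof -
      have "Complex (poly (?p (Re k)) t) (poly (?p (Im k)) t) = of_real ((1 - t\<^sup>2) ^ a * t ^ c) * k"
        by (simp add: complex_eq_iff poly_monom power2_eq_square mult_ac)
      then show ?thesis by (simp add: mult_ac)
    qed
    show ?thesis
    proof (intro exI conjI)
      show "degree (?p (Re k)) \<le> d" "degree (?p (Im k)) \<le> d" by (rule deg)+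
      show "?f north_pole = Complex (poly (?p (Re k)) 1) (poly (?p (Im k)) 1)"
        using True by (simp add: pole power_0_left poly_monom complex_eq_iff)
      show "\<forall>\<psi>. \<psi> \<in> borel_measurable borel \<longrightarrow> set_integrable lborel {-1..1} \<psi> \<longrightarrow>
         (LINT x|sphere_measure. ?f x * \<psi> (x $ 3))
           = 2 * pi * (LINT t:{-1..1}|lborel. Complex (poly (?p (Re k)) t) (poly (?p (Im k)) t) * \<psi> t)"
        unfolding e[symmetric] using int True by simp
    qed
  next
    case False
    then show ?thesis
      by (intro exI[of _ 0]) (auto simp: int pole power_0_left complex_eq_iff Complex_eq_0)
  qed
next
  case (add f g)
  obtain p q where pq: "degree p \<le> d" "degree q \<le> d" "f north_pole = Complex (poly p 1) (poly q 1)"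
    "\<And>\<psi>. \<psi> \<in> borel_measurable borel \<Longrightarrow> set_integrable lborel {-1..1} \<psi> \<Longrightarrow>
         (LINT x|sphere_measure. f x * \<psi> (x $ 3))
           = 2 * pi * (LINT t:{-1..1}|lborel. Complex (poly p t) (poly q t) * \<psi> t)"
    using add.IH(1) by blast
  obtain r s where rs: "degree r \<le> d" "degree s \<le> d" "g north_pole = Complex (poly r 1) (poly s 1)"
    "\<And>\<psi>. \<psi> \<in> borel_measurable borel \<Longrightarrow> set_integrable lborel {-1..1} \<psi> \<Longrightarrow>
         (LINT x|sphere_measure. g x * \<psi> (x $ 3))
           = 2 * pi * (LINT t:{-1..1}|lborel. Complex (poly r t) (poly s t) * \<psi> t)"
    using add.IH(2) by blast
  show ?case
  proof (rule exI[of _ "p + r"], rule exI[of _ "q + s"], intro conjI allI impI)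
    show "degree (p + r) \<le> d" "degree (q + s) \<le> d" using pq rs by (auto intro: degree_add_le)
    show "f north_pole + g north_pole = Complex (poly (p + r) 1) (poly (q + s) 1)"
      by (simp add: pq rs complex_eq_iff)
    fix \<psi> :: "real \<Rightarrow> complex"
    assume \<psi>[measurable]: "\<psi> \<in> borel_measurable borel" and int: "set_integrable lborel {-1..1} \<psi>"
    have int': "integrable sphere_measure (\<lambda>x. \<psi> (x $ 3))"
      using sphere_integrable_zonal_iff[OF \<psi>] int by simp
    have *: "set_integrable lborel {-1..1} (\<lambda>t. Complex (poly p t) (poly q t) * \<psi> t)" for p q
    proof -
      have c: "Complex (poly p t) (poly q t) = of_real (poly p t) + \<i> * of_real (poly q t)" for t
        by (simp add: complex_eq_iff)
      have "sphere_poly (max (degree p) (degree q)) (\<lambda>x. of_real (poly p (x $ 3)) + \<i> * of_real (poly q (x $ 3)))"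
        by (intro sphere_poly.add sphere_poly_cmult sphere_poly_of_poly) auto
      from sphere_poly_mult_integrable[OF this int'] show ?thesis
        by (subst sphere_integrable_zonal_iff[symmetric]) (auto simp: c)
    qed
    have "(LINT x|sphere_measure. (f x + g x) * \<psi> (x $ 3))
        = (LINT x|sphere_measure. f x * \<psi> (x $ 3)) + (LINT x|sphere_measure. g x * \<psi> (x $ 3))"
      by (subst Bochner_Integration.integral_add[symmetric])
         (auto simp: distrib_right intro!: sphere_poly_mult_integrable[OF _ int'] add.hyps)
    also have "\<dots> = 2 * pi * ((LINT t:{-1..1}|lborel. Complex (poly p t) (poly q t) * \<psi> t)
          + (LINT t:{-1..1}|lborel. Complex (poly r t) (poly s t) * \<psi> t))"
      using pq(4)[OF \<psi> int] rs(4)[OF \<psi> int] by (simp add: distrib_left)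
    also have "(LINT t:{-1..1}|lborel. Complex (poly p t) (poly q t) * \<psi> t)
          + (LINT t:{-1..1}|lborel. Complex (poly r t) (poly s t) * \<psi> t)
        = (LINT t:{-1..1}|lborel. Complex (poly (p + r) t) (poly (q + s) t) * \<psi> t)"
      by (subst set_integral_add(2)[symmetric, OF * *])
         (simp only: distrib_right[symmetric] complex_add poly_add)
    finally show "(LINT x|sphere_measure. (f x + g x) * \<psi> (x $ 3))
        = 2 * pi * (LINT t:{-1..1}|lborel. Complex (poly (p + r) t) (poly (q + s) t) * \<psi> t)" .
  qed
next
  case (cong f g)
  have "(LINT x|sphere_measure. g x * \<psi> (x $ 3)) = (LINT x|sphere_measure. f x * \<psi> (x $ 3))" for \<psi>
    using cong(2) by (intro Bochner_Integration.integral_cong) auto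
  moreover have "g north_pole = f north_pole"
    using cong(2)[OF north_pole_in_S2] by simp
  ultimately show ?case using cong.IH by simp
qed

section \<open>Spherical harmonics and the Funk-Hecke formula\<close>

text \<open>The spherical harmonics of degree \<open>l\<close>, characterized by orthogonality to lower degrees instead of
  Laplace's equation. In this form invariance under rotations is inherited from the measure and from
  the degree, and different degrees are orthogonal by definition. The pairing is bilinear rather than
  Hermitian, which makes no difference because polynomials of degree \<open>d\<close> are closed under
  conjugation.\<close>

definition harmonic :: "nat \<Rightarrow> (real^3 \<Rightarrow> complex) \<Rightarrow> bool" where
  "harmonic l f \<longleftrightarrow> sphere_poly l f \<and>
     (\<forall>d q. d < l \<longrightarrow> sphere_poly d q \<longrightarrow> (LINT x|sphere_measure. f x * q x) = 0)"

lemma harmonic_sphere_poly: "harmonic l f \<Longrightarrow> sphere_poly l f"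
  by (simp add: harmonic_def)

lemma harmonic_orthogonal_lower:
  "harmonic l f \<Longrightarrow> d < l \<Longrightarrow> sphere_poly d q \<Longrightarrow> (LINT x|sphere_measure. f x * q x) = 0"
  by (simp add: harmonic_def)

lemma harmonic_cong:
  assumes "harmonic l f" "\<And>x. x \<in> S2 \<Longrightarrow> f x = g x"
  shows "harmonic l g"
proof -
  have "(LINT x|sphere_measure. g x * q x) = (LINT x|sphere_measure. f x * q x)" for q
    using assms(2) by (intro Bochner_Integration.integral_cong) auto
  then show ?thesis
    using assms by (auto simp: harmonic_def intro: sphere_poly.cong)
qed

lemma harmonic_cmult: "harmonic l f \<Longrightarrow> harmonic l (\<lambda>x. k * f x)"
  by (auto simp: harmonic_def mult.assoc intro: sphere_poly_cmult)

lemma harmonic_sum: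
  assumes "\<And>i. i \<in> I \<Longrightarrow> harmonic l (f i)"
  shows "harmonic l (\<lambda>x. \<Sum>i\<in>I. f i x)"
  unfolding harmonic_def
proof (intro conjI allI impI)
  show "sphere_poly l (\<lambda>x. \<Sum>i\<in>I. f i x)"
    by (rule sphere_poly_sum) (use assms harmonic_sphere_poly in auto)
  fix d q assume d: "d < l" and q: "sphere_poly d q"
  have "(LINT x|sphere_measure. (\<Sum>i\<in>I. f i x) * q x) = (LINT x|sphere_measure. (\<Sum>i\<in>I. f i x * q x))"
    by (simp add: sum_distrib_right)
  also have "\<dots> = (\<Sum>i\<in>I. LINT x|sphere_measure. f i x * q x)"
    by (intro Bochner_Integration.integral_sum sphere_poly_mult_integrable[OF harmonic_sphere_poly[OF assms]]
        sphere_poly_integrable[OF q])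
  also have "\<dots> = 0"
    using harmonic_orthogonal_lower[OF assms d q] by simp
  finally show "(LINT x|sphere_measure. (\<Sum>i\<in>I. f i x) * q x) = 0" .
qed

lemma harmonic_cnj:
  fixes f :: "real^3 \<Rightarrow> complex"
  assumes "harmonic l f"
  shows "harmonic l (\<lambda>x. cnj (f x))"
  unfolding harmonic_def
proof (intro conjI allI impI)
  show "sphere_poly l (\<lambda>x. cnj (f x))"
    by (rule sphere_poly_cnj[OF harmonic_sphere_poly[OF assms]])
  fix d q assume d: "d < l" and q: "sphere_poly d q"
  have "(LINT x|sphere_measure. cnj (f x) * q x) = cnj (LINT x|sphere_measure. f x * cnj (q x))"
  proof -
    have "(LINT x|sphere_measure. cnj (f x) * q x) = (LINT x|sphere_measure. cnj (f x * cnj (q x)))" by simp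
    also have "\<dots> = cnj (LINT x|sphere_measure. f x * cnj (q x))" by (rule Bochner_Integration.integral_cnj)
    finally show ?thesis .
  qed
  then show "(LINT x|sphere_measure. cnj (f x) * q x) = 0"
    using harmonic_orthogonal_lower[OF assms d sphere_poly_cnj[OF q]] by simp
qed

lemma harmonic_orthogonal_transformation:
  fixes f :: "real^3 \<Rightarrow> complex"
  assumes R: "orthogonal_transformation R" and f: "harmonic l f"
  shows "harmonic l (\<lambda>x. f (R x))"
  unfolding harmonic_def
proof (intro conjI allI impI)
  show "sphere_poly l (\<lambda>x. f (R x))"
    by (rule sphere_poly_orthogonal[OF R harmonic_sphere_poly[OF f]])
  fix d q assume d: "d < l" and q: "sphere_poly d q"
  have q': "sphere_poly d (\<lambda>x. q (inv R x))"
    by (rule sphere_poly_orthogonal[OF orthogonal_transformation_inv[OF R] q])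
  have inv: "inv R (R x) = x" for x
    using orthogonal_transformation_inj[OF R] by simp
  note [measurable] = sphere_poly_measurable[OF harmonic_sphere_poly[OF f]] sphere_poly_measurable[OF q']
  have "(LINT x|sphere_measure. f (R x) * q x) = (LINT x|sphere_measure. f (R x) * q (inv R (R x)))"
    by (simp add: inv)
  also have "\<dots> = (LINT x|sphere_measure. f x * q (inv R x))"
    by (rule sphere_integral_orthogonal[OF R, of "\<lambda>x. f x * q (inv R x)"]) measurable
  also have "\<dots> = 0" by (rule harmonic_orthogonal_lower[OF f d q'])
  finally show "(LINT x|sphere_measure. f (R x) * q x) = 0" .
qed

lemma harmonic_mutually_orthogonal:
  fixes f g :: "real^3 \<Rightarrow> complex"
  assumes f: "harmonic l f" and g: "harmonic k g" and "l \<noteq> k"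
  shows "(LINT x|sphere_measure. f x * cnj (g x)) = 0"
proof (cases "k < l")
  case True
  then show ?thesis
    using harmonic_orthogonal_lower[OF f True] sphere_poly_cnj[OF harmonic_sphere_poly[OF g]] by simp
next
  case False
  then have "l < k" using assms by simp
  from harmonic_orthogonal_lower[OF harmonic_cnj[OF g] this harmonic_sphere_poly[OF f]]
  show ?thesis by (simp add: mult.commute)
qed

text \<open>The average of \<open>f\<close> over the circles of latitude is a polynomial of degree at most \<open>l\<close> that inherits
  from \<open>f\<close> the orthogonality to lower degrees. So it is a multiple of \<open>P\<^bsub>l\<^esub>\<close>, and the value at the pole
  gives the factor.\<close>

lemma harmonic_zonal_average:
  fixes f :: "real^3 \<Rightarrow> complex" and \<psi> :: "real \<Rightarrow> complex"
  assumes f: "harmonic l f"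
    and \<psi>: "\<psi> \<in> borel_measurable borel" "set_integrable lborel {-1..1} \<psi>"
  shows "(LINT x|sphere_measure. f x * \<psi> (x $ 3))
    = 2 * pi * (LINT t:{-1..1}|lborel. of_real (poly (legendre l) t) * \<psi> t) * f north_pole"
proof -
  obtain p q where deg: "degree p \<le> l" "degree q \<le> l"
    and pole: "f north_pole = Complex (poly p 1) (poly q 1)"
    and avg: "\<And>\<psi>. \<psi> \<in> borel_measurable borel \<Longrightarrow> set_integrable lborel {-1..1} \<psi> \<Longrightarrow>
         (LINT x|sphere_measure. f x * \<psi> (x $ 3))
           = 2 * pi * (LINT t:{-1..1}|lborel. Complex (poly p t) (poly q t) * \<psi> t)"
    using sphere_poly_zonal_average[OF harmonic_sphere_poly[OF f]] by blast
  have orth: "integral {-1..1} (poly (p * u)) = 0 \<and> integral {-1..1} (poly (q * u)) = 0"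
    if "degree u < l" for u
  proof -
    have "0 = (LINT x|sphere_measure. f x * of_real (poly u (x $ 3)))"
      by (rule harmonic_orthogonal_lower[OF f that sphere_poly_of_poly, symmetric]) simp
    also have "\<dots> = 2 * pi * (LINT t:{-1..1}|lborel. Complex (poly p t) (poly q t) * of_real (poly u t))"
      by (rule avg) (measurable, intro borel_integrable_atLeastAtMost' continuous_intros)
    also have "(LINT t:{-1..1}|lborel. Complex (poly p t) (poly q t) * of_real (poly u t))
        = (LINT t:{-1..1}|lborel. Complex (poly (p * u) t) (poly (q * u) t))"
      by (rule arg_cong[where f = "\<lambda>h. set_lebesgue_integral lborel {-1..1} h"])
         (rule ext, simp add: complex_eq_iff)
    finally show ?thesis
      unfolding set_integral_Complex_poly by (simp add: complex_eq_iff)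
  qed
  have p: "p = smult (poly p 1) (legendre l)" and q: "q = smult (poly q 1) (legendre l)"
    using orth by (intro legendre_unique deg; simp add: poly_mult[abs_def])+
  have pq: "Complex (poly p t) (poly q t) = f north_pole * of_real (poly (legendre l) t)" for t
    using arg_cong[OF p, of "\<lambda>r. poly r t"] arg_cong[OF q, of "\<lambda>r. poly r t"]
    unfolding pole by (simp add: complex_eq_iff)
  show ?thesis
    unfolding avg[OF \<psi>] pq by (simp only: mult.assoc set_integral_mult_right) (simp add: mult_ac)
qed

text \<open>Rotating \<open>x\<close> to the north pole reduces the Funk-Hecke formula to the previous lemma, applied to
  the rotated function.\<close>

lemma funk_hecke:
  fixes f :: "real^3 \<Rightarrow> complex" and \<psi> :: "real \<Rightarrow> complex"
  assumes f: "harmonic l f" and x: "x \<in> S2"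
    and \<psi>: "\<psi> \<in> borel_measurable borel" "set_integrable lborel {-1..1} \<psi>"
  shows "(LINT y|sphere_measure. f y * \<psi> (x \<bullet> y))
    = 2 * pi * (LINT t:{-1..1}|lborel. of_real (poly (legendre l) t) * \<psi> t) * f x"
proof -
  obtain R where R: "orthogonal_transformation R" and Rx: "R north_pole = x"
    and third: "\<And>y. x \<bullet> R y = y $ 3"
    using rotation_to_point[OF x] by blast
  have "(\<lambda>y. x \<bullet> y) \<in> borel_measurable sphere_measure"
    by (rule measurable_sphere_borel) measurable
  then have meas: "(\<lambda>y. f y * \<psi> (x \<bullet> y)) \<in> borel_measurable sphere_measure"
    by (intro borel_measurable_times sphere_poly_measurable[OF harmonic_sphere_poly[OF f]]
        measurable_compose[OF _ \<psi>(1)])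
  have "(LINT y|sphere_measure. f y * \<psi> (x \<bullet> y)) = (LINT y|sphere_measure. f (R y) * \<psi> (x \<bullet> R y))"
    by (rule sphere_integral_orthogonal[OF R meas, symmetric])
  also have "\<dots> = (LINT y|sphere_measure. f (R y) * \<psi> (y $ 3))"
    by (simp only: third)
  also have "\<dots> = 2 * pi * (LINT t:{-1..1}|lborel. of_real (poly (legendre l) t) * \<psi> t) * f (R north_pole)"
    by (rule harmonic_zonal_average[OF harmonic_orthogonal_transformation[OF R f] \<psi>])
  finally show ?thesis unfolding Rx .
qed

lemma orthogonal_to_sphere_poly_if_monomials:
  fixes f :: "real^3 \<Rightarrow> complex"
  assumes f: "integrable sphere_measure f" and "sphere_poly d q"
    and mono: "\<And>a b c. a + b + c \<le> d \<Longrightarrow>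
      (LINT x|sphere_measure. f x * (horiz x ^ a * cnj (horiz x) ^ b * of_real (x $ 3) ^ c)) = 0"
  shows "(LINT x|sphere_measure. f x * q x) = 0"
  using assms(2)
proof (induction rule: sphere_poly.induct)
  case (monomial a b c k)
  have "(LINT x|sphere_measure. f x * (k * horiz x ^ a * cnj (horiz x) ^ b * of_real (x $ 3) ^ c))
     = (LINT x|sphere_measure. k * (f x * (horiz x ^ a * cnj (horiz x) ^ b * of_real (x $ 3) ^ c)))"
    by (simp add: mult_ac)
  then show ?case using mono[OF monomial] by simp
next
  case (add q r)
  have "integrable sphere_measure (\<lambda>x. f x * q x)" "integrable sphere_measure (\<lambda>x. f x * r x)"
    using sphere_poly_mult_integrable[OF add.hyps(1) f] sphere_poly_mult_integrable[OF add.hyps(2) f]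
    by (simp_all add: mult.commute)
  with add.IH show ?case by (simp add: distrib_left)
next
  case (cong q r)
  have "(LINT x|sphere_measure. f x * r x) = (LINT x|sphere_measure. f x * q x)"
    using cong(2) by (intro Bochner_Integration.integral_cong) auto
  with cong.IH show ?case by simp
qed

text \<open>The common form of all \<open>Y\<^bsub>l\<^esub>\<^bsup>m\<^esup>\<close>, up to conjugation and constants. Among the monomials in
  \<open>w\<close>, \<open>cnj w\<close>, \<open>x\<^sub>3\<close> only those with matching azimuthal frequency can fail to be orthogonal to it, and
  for them the integral over the sphere becomes the one in the hypothesis.\<close>

lemma harmonic_horiz_power:
  fixes u :: "real poly"
  assumes deg: "k + degree u \<le> l"
    and orth: "\<And>a c. 2 * a + k + c < l \<Longrightarrow>
      integral {-1..1} (poly ([:1, 0, -1:] ^ (k + a) * monom 1 c * u)) = 0"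
  shows "harmonic l (\<lambda>x. horiz x ^ k * of_real (poly u (x $ 3)))"
  unfolding harmonic_def
proof (intro conjI allI impI)
  have "sphere_poly l (\<lambda>x. \<Sum>i\<le>degree u. of_real (coeff u i) * horiz x ^ k * cnj (horiz x) ^ 0 * of_real (x $ 3) ^ i)"
    by (rule sphere_poly_sum, rule sphere_poly.monomial) (use deg in auto)
  then show sp: "sphere_poly l (\<lambda>x. horiz x ^ k * of_real (poly u (x $ 3)))"
    by (simp add: poly_altdef sum_distrib_left mult_ac)
  fix d q assume d: "d < l" and q: "sphere_poly d q"
  show "(LINT x|sphere_measure. horiz x ^ k * of_real (poly u (x $ 3)) * q x) = 0"
  proof (rule orthogonal_to_sphere_poly_if_monomials[OF sphere_poly_integrable[OF sp] q])
    fix a b c assume abc: "a + b + c \<le> d"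
    have "(LINT x|sphere_measure. horiz x ^ k * of_real (poly u (x $ 3))
              * (horiz x ^ a * cnj (horiz x) ^ b * of_real (x $ 3) ^ c))
        = (LINT x|sphere_measure. horiz x ^ (k + a) * cnj (horiz x) ^ b * of_real (poly (monom 1 c * u) (x $ 3)))"
      by (simp add: power_add poly_monom mult_ac)
    also have "\<dots> = (if k + a = b then 2 * pi * (LINT t:{-1..1}|lborel.
        complex_of_real ((1 - t\<^sup>2) ^ (k + a)) * complex_of_real (poly (monom 1 c * u) t)) else 0)"
      by (rule sphere_integral_monomial) measurable
    also have "\<dots> = 0"
    proof (cases "k + a = b")
      case True
      have "(\<lambda>t. of_real ((1 - t\<^sup>2) ^ (k + a)) * of_real (poly (monom 1 c * u) t))
          = (\<lambda>t. complex_of_real (poly ([:1, 0, -1:] ^ (k + a) * monom 1 c * u) t))"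
        by (simp add: fun_eq_iff power2_eq_square poly_power)
      then show ?thesis
        using orth[of a c] True abc d by (simp only: set_integral_complex_of_real set_integral_poly) simp
    qed simp
    finally show "(LINT x|sphere_measure. horiz x ^ k * of_real (poly u (x $ 3))
              * (horiz x ^ a * cnj (horiz x) ^ b * of_real (x $ 3) ^ c)) = 0" .
  qed
qed

lemma harmonic_horiz_power_rodrigues:
  assumes "k \<le> l"
  shows "harmonic l (\<lambda>x. horiz x ^ k * of_real (poly ((pderiv ^^ (k + l)) ([:1, 0, -1:] ^ l)) (x $ 3)))"
proof (rule harmonic_horiz_power)
  show "k + degree ((pderiv ^^ (k + l)) ([:1, 0, -1 :: real:] ^ l)) \<le> l"
    using assms by (simp add: degree_higher_pderiv degree_power_eq)
  fix a c assume ac: "2 * a + k + c < l"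
  show "integral {-1..1} (poly ([:1, 0, -1 :: real:] ^ (k + a) * monom 1 c * (pderiv ^^ (k + l)) ([:1, 0, -1:] ^ l))) = 0"
  proof (rule integral_mult_rodrigues_eq_0)
    show "[:1, 0, -1:] ^ (k + l - l) dvd [:1, 0, -1 :: real:] ^ (k + a) * monom 1 c"
      by (simp add: power_add)
    have "degree ([:1, 0, -1 :: real:] ^ (k + a) * monom 1 c) \<le> 2 * (k + a) + c"
      by (rule order_trans[OF degree_mult_le]) (simp add: degree_power_eq degree_monom_eq)
    then show "degree ([:1, 0, -1 :: real:] ^ (k + a) * monom 1 c) < k + l"
      using ac by simp
  qed
qed

text \<open>For negative order \<open>m = - k\<close> the factor \<open>(1 - t\<^sup>2)\<close> to the power \<open>m / 2\<close> in the associated Legendre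
  function is singular; the factor \<open>(1 - t\<^sup>2) ^ k\<close> that the derivative of order \<open>l - k\<close> contains
  compensates it and leaves the quotient \<open>q\<close>.\<close>

lemma harmonic_horiz_power_rodrigues_quotient:
  fixes q :: "real poly"
  assumes kl: "k \<le> l" and q: "(pderiv ^^ (l - k)) ([:1, 0, -1:] ^ l) = [:1, 0, -1:] ^ k * q"
  shows "harmonic l (\<lambda>x. horiz x ^ k * of_real (poly q (x $ 3)))"
proof (rule harmonic_horiz_power)
  have "degree ([:1, 0, -1:] ^ k * q) = l + k"
    unfolding q[symmetric] using kl by (simp add: degree_higher_pderiv degree_power_eq)
  moreover from this have "q \<noteq> 0" if "0 < l + k" using that by auto
  ultimately show "k + degree q \<le> l"
    using kl by (cases "q = 0") (auto simp: degree_mult_eq degree_power_eq)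
  fix a c assume ac: "2 * a + k + c < l"
  have "[:1, 0, -1:] ^ (k + a) * monom 1 c * q
      = [:1, 0, -1:] ^ a * monom 1 c * (pderiv ^^ (l - k)) ([:1, 0, -1:] ^ l)"
    unfolding q by (simp add: power_add mult_ac)
  also have "integral {-1..1} (poly \<dots>) = 0"
  proof (rule integral_mult_rodrigues_eq_0)
    show "[:1, 0, -1:] ^ (l - k - l) dvd [:1, 0, -1 :: real:] ^ a * monom 1 c" by simp
    have "degree ([:1, 0, -1 :: real:] ^ a * monom 1 c) \<le> 2 * a + c"
      by (rule order_trans[OF degree_mult_le]) (simp add: degree_power_eq degree_monom_eq)
    then show "degree ([:1, 0, -1 :: real:] ^ a * monom 1 c) < l - k"
      using ac by simp
  qed
  finally show "integral {-1..1} (poly ([:1, 0, -1:] ^ (k + a) * monom 1 c * q)) = 0" .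
qed

lemma harmonic_sph_harm:
  assumes m: "\<bar>m\<bar> \<le> int l"
  shows "harmonic l (sph_harm l m)"
proof -
  define K where "K = complex_of_real (sqrt ((2 * real l + 1) / (4 * pi)
      * (fact (nat (int l - m)) / fact (nat (int l + m)))) * ((- 1) ^ nat (m + int l) / (2 ^ l * fact l)))"
  define n where "n = nat (m + int l)"
  have polar: "sph_harm l m x = K * (of_real (sqrt (1 - (x $ 3)\<^sup>2) powi m) * exp (\<i> * of_int m * of_real (Arg (horiz x))))
      * of_real (poly ((pderiv ^^ n) ([:1, 0, -1:] ^ l)) (x $ 3))" if "x \<in> S2" for x
    using sphere_third_coord[OF that]
    by (simp add: sph_harm_def sph_harm_coord_def assoc_legendre_def K_def n_def horiz_def mult_ac)
  have arg: "horiz x = of_real (sqrt (1 - (x $ 3)\<^sup>2)) * exp (\<i> * of_real (Arg (horiz x)))" if "x \<in> S2" for x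
    using Arg_eq[of "horiz x"] cmod_horiz[OF that] by (cases "horiz x = 0") auto
  show ?thesis
  proof (cases "0 \<le> m")
    case True
    define k where "k = nat m"
    have 1: "m = int k" "k \<le> l" using m True by (auto simp: k_def)
    have nk: "n = k + l" using 1 by (simp add: n_def)
    have "of_real (sqrt (1 - (x $ 3)\<^sup>2) powi m) * exp (\<i> * of_int m * of_real (Arg (horiz x))) = horiz x ^ k"
      if x: "x \<in> S2" for x
    proof -
      have "exp (\<i> * of_int m * of_real (Arg (horiz x))) = exp (\<i> * of_real (Arg (horiz x))) ^ k"
        unfolding exp_of_nat_mult[symmetric] by (simp add: 1 mult_ac)
      then show ?thesis
        by (subst arg[OF x]) (simp add: 1 power_mult_distrib)
    qed
    then have "K * (horiz x ^ k * of_real (poly ((pderiv ^^ (k + l)) ([:1, 0, -1:] ^ l)) (x $ 3))) = sph_harm l m x"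
      if "x \<in> S2" for x
      using polar[OF that] that by (simp add: nk mult.assoc)
    with harmonic_cmult[OF harmonic_horiz_power_rodrigues[OF 1(2)]] show ?thesis
      by (rule harmonic_cong)
  next
    case False
    define k where "k = nat (- m)"
    have 2: "m = - int k" "0 < k" "k \<le> l" using m False by (auto simp: k_def)
    have nk: "n = l - k" using 2 by (simp add: n_def)
    have "[:1, 0, -1 :: real:] ^ (l - (l - k)) dvd (pderiv ^^ (l - k)) ([:1, 0, -1:] ^ l)"
      by (rule power_dvd_higher_pderiv) simp
    then obtain q where q: "(pderiv ^^ (l - k)) ([:1, 0, -1 :: real:] ^ l) = [:1, 0, -1:] ^ k * q"
      using 2 by (auto elim: dvdE)
    have "K * cnj (horiz x ^ k * of_real (poly q (x $ 3))) = sph_harm l m x" if x: "x \<in> S2" for x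
    proof -
      define s where "s = sqrt (1 - (x $ 3)\<^sup>2)"
      have "0 \<le> 1 - (x $ 3)\<^sup>2"
        using sphere_third_coord[OF x] by (simp add: abs_square_le_1 abs_le_iff)
      then have s2: "poly [:1, 0, -1:] (x $ 3) = s\<^sup>2"
        unfolding s_def by (simp add: power2_eq_square)
      define e where "e = exp (\<i> * of_real (Arg (horiz x)))"
      have e: "exp (\<i> * of_int m * of_real (Arg (horiz x))) = cnj e ^ k"
        unfolding e_def exp_cnj exp_of_nat_mult[symmetric] by (simp add: 2 mult_ac)
      have h: "horiz x = of_real s * e" unfolding s_def e_def by (rule arg[OF x])
      \<comment> \<open>The case \<open>s = 0\<close> is that of the poles, where both sides vanish because \<open>k > 0\<close>.\<close>
      have p: "s powi m * (s\<^sup>2) ^ k = s ^ k"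
      proof (cases "s = 0")
        case False
        have "(s\<^sup>2) ^ k = s ^ k * s ^ k" by (simp add: power2_eq_square power_mult_distrib)
        then show ?thesis using False by (simp add: 2 power_int_minus)
      qed (use 2 in simp)
      have "sph_harm l m x = K * (of_real (s powi m) * cnj e ^ k) * of_real ((s\<^sup>2) ^ k * poly q (x $ 3))"
        unfolding polar[OF x] e nk q s_def[symmetric] by (simp only: poly_mult poly_power s2)
      also have "\<dots> = K * (of_real (s powi m * (s\<^sup>2) ^ k) * cnj e ^ k * of_real (poly q (x $ 3)))"
        by (simp add: mult_ac)
      also have "\<dots> = K * cnj (horiz x ^ k * of_real (poly q (x $ 3)))"
        unfolding p h by (simp add: power_mult_distrib)
      finally show ?thesis by simp
    qed
    with harmonic_cmult[OF harmonic_cnj[OF harmonic_horiz_power_rodrigues_quotient[OF 2(3) q]]] show ?thesis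
      by (rule harmonic_cong)
  qed
qed

section \<open>Square integrable functions and convolution\<close>

lemma L2_norm_square: "(L2_norm f)\<^sup>2 = (LINT x|sphere_measure. (cmod (f x))\<^sup>2)"
  unfolding L2_norm_def by (rule real_sqrt_pow2) simp

lemma L2_norm_square_zero: "L2_zero f \<Longrightarrow> (L2_norm f)\<^sup>2 = 0"
  unfolding L2_norm_square L2_zero_def by (rule integral_eq_zero_AE) auto

lemma L2_norm_square_pos:
  assumes "f \<in> L2_sphere" "\<not> L2_zero f"
  shows "0 < (L2_norm f)\<^sup>2"
proof (rule ccontr)
  assume "\<not> 0 < (L2_norm f)\<^sup>2"
  then have "(LINT x|sphere_measure. (cmod (f x))\<^sup>2) = 0"
    unfolding L2_norm_square[symmetric] by simp
  then have "AE x in sphere_measure. (cmod (f x))\<^sup>2 = 0"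
    using assms(1) by (subst (asm) integral_nonneg_eq_0_iff_AE) (auto simp: L2_sphere_def)
  with assms(2) show False by (simp add: L2_zero_def)
qed

lemma L2_norm_square_cong: "(\<And>x. x \<in> S2 \<Longrightarrow> f x = g x) \<Longrightarrow> (L2_norm f)\<^sup>2 = (L2_norm g)\<^sup>2"
  unfolding L2_norm_square by (rule Bochner_Integration.integral_cong) auto

lemma L2_sphere_mult_integrable:
  assumes f: "f \<in> L2_sphere" and g: "g \<in> L2_sphere"
  shows "integrable sphere_measure (\<lambda>x. f x * g x)"
proof -
  have [measurable]: "f \<in> borel_measurable sphere_measure" "g \<in> borel_measurable sphere_measure"
    using f g by (auto simp: L2_sphere_def)
  have "integrable sphere_measure (\<lambda>x. (cmod (f x))\<^sup>2 + (cmod (g x))\<^sup>2)"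
    using f g by (auto simp: L2_sphere_def)
  then show ?thesis
  proof (rule Bochner_Integration.integrable_bound)
    have "cmod (f x * g x) \<le> (cmod (f x))\<^sup>2 + (cmod (g x))\<^sup>2" for x
    proof -
      have "2 * cmod (f x) * cmod (g x) \<le> (cmod (f x))\<^sup>2 + (cmod (g x))\<^sup>2"
        by (rule sum_squares_bound)
      moreover have "0 \<le> cmod (f x) * cmod (g x)" by simp
      ultimately show ?thesis unfolding norm_mult by linarith
    qed
    then show "AE x in sphere_measure. norm (f x * g x) \<le> norm ((cmod (f x))\<^sup>2 + (cmod (g x))\<^sup>2)"
      by simp
  qed measurable
qed

text \<open>With \<open>U\<close>, \<open>V\<close> the squared norms of \<open>f\<close>, \<open>g\<close> and \<open>I\<close> the integral of \<open>\<bar>f g\<bar>\<close>, the integral of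
  \<open>(V \<bar>f\<bar> - I \<bar>g\<bar>)\<^sup>2\<close> equals \<open>V (U V - I\<^sup>2)\<close>.\<close>

lemma L2_sphere_cauchy_schwarz:
  assumes f: "f \<in> L2_sphere" and g: "g \<in> L2_sphere" and "\<not> L2_zero g"
  shows "(cmod (LINT x|sphere_measure. f x * g x))\<^sup>2 \<le> (L2_norm f)\<^sup>2 * (L2_norm g)\<^sup>2"
proof -
  define U V I where "U = (L2_norm f)\<^sup>2" and "V = (L2_norm g)\<^sup>2"
    and "I = (LINT x|sphere_measure. cmod (f x * g x))"
  have V: "0 < V" unfolding V_def using g \<open>\<not> L2_zero g\<close> by (rule L2_norm_square_pos)
  have int: "integrable sphere_measure (\<lambda>x. (cmod (f x))\<^sup>2)" "integrable sphere_measure (\<lambda>x. (cmod (g x))\<^sup>2)"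
    "integrable sphere_measure (\<lambda>x. cmod (f x * g x))"
    using f g L2_sphere_mult_integrable[OF f g] by (auto simp: L2_sphere_def)
  have "0 \<le> (LINT x|sphere_measure. (V * cmod (f x) - I * cmod (g x))\<^sup>2)" by simp
  also have "\<dots> = (LINT x|sphere_measure. V\<^sup>2 * (cmod (f x))\<^sup>2 - 2 * V * I * cmod (f x * g x) + I\<^sup>2 * (cmod (g x))\<^sup>2)"
    by (intro Bochner_Integration.integral_cong) (auto simp: power2_eq_square norm_mult algebra_simps)
  also have "\<dots> = V\<^sup>2 * U - 2 * V * I * I + I\<^sup>2 * V"
    using int by (simp add: U_def V_def I_def L2_norm_square)
  also have "\<dots> = V * (U * V - I\<^sup>2)" by (simp add: power2_eq_square algebra_simps)
  finally have "I\<^sup>2 \<le> U * V" using V by (simp add: zero_le_mult_iff)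
  moreover have "cmod (LINT x|sphere_measure. f x * g x) \<le> I"
    unfolding I_def by (rule integral_norm_bound)
  then have "(cmod (LINT x|sphere_measure. f x * g x))\<^sup>2 \<le> I\<^sup>2"
    by (rule power_mono) simp
  ultimately show ?thesis unfolding U_def V_def by simp
qed

lemma sphere_poly_L2:
  assumes "sphere_poly d f"
  shows "f \<in> L2_sphere"
proof -
  have "integrable sphere_measure (\<lambda>x. f x * cnj (f x))"
    by (rule sphere_poly_mult_integrable[OF assms sphere_poly_integrable[OF sphere_poly_cnj[OF assms]]])
  then have "integrable sphere_measure (\<lambda>x. complex_of_real ((cmod (f x))\<^sup>2))"
    by (simp only: complex_norm_square)
  then show ?thesis
    using sphere_poly_measurable[OF assms] unfolding L2_sphere_def
    by (auto simp: complex_of_real_integrable_eq simp del: of_real_power)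
qed

lemma L2_norm_harmonic_sum:
  assumes f: "\<And>l. l \<in> I \<Longrightarrow> harmonic l (f l)"
  shows "(L2_norm (\<lambda>x. \<Sum>l\<in>I. c l * f l x))\<^sup>2 = (\<Sum>l\<in>I. (cmod (c l))\<^sup>2 * (L2_norm (f l))\<^sup>2)"
proof (cases "finite I")
  case True
  let ?F = "\<lambda>x. \<Sum>l\<in>I. c l * f l x"
  have sq: "complex_of_real ((L2_norm h)\<^sup>2) = (LINT x|sphere_measure. h x * cnj (h x))" for h
    unfolding L2_norm_square complex_norm_square[symmetric] by (rule integral_complex_of_real[symmetric])
  have int: "integrable sphere_measure (\<lambda>x. f l x * cnj (f k x))" if "l \<in> I" "k \<in> I" for l k
    by (rule sphere_poly_mult_integrable[OF harmonic_sphere_poly[OF f[OF that(1)]]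
          sphere_poly_integrable[OF sphere_poly_cnj[OF harmonic_sphere_poly[OF f[OF that(2)]]]]])
  have "complex_of_real ((L2_norm ?F)\<^sup>2) = (LINT x|sphere_measure. ?F x * cnj (?F x))"
    by (rule sq)
  also have "\<dots> = (LINT x|sphere_measure. (\<Sum>l\<in>I. \<Sum>k\<in>I. (c l * cnj (c k)) * (f l x * cnj (f k x))))"
    by (simp add: sum_product mult_ac)
  also have "\<dots> = (\<Sum>l\<in>I. \<Sum>k\<in>I. (c l * cnj (c k)) * (LINT x|sphere_measure. f l x * cnj (f k x)))"
    using int by (simp add: Bochner_Integration.integral_sum)
  also have "\<dots> = (\<Sum>l\<in>I. \<Sum>k\<in>I. if l = k then complex_of_real ((cmod (c l))\<^sup>2 * (L2_norm (f l))\<^sup>2) else 0)"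
  proof (intro sum.cong refl)
    fix l k assume lk: "l \<in> I" "k \<in> I"
    show "(c l * cnj (c k)) * (LINT x|sphere_measure. f l x * cnj (f k x))
        = (if l = k then complex_of_real ((cmod (c l))\<^sup>2 * (L2_norm (f l))\<^sup>2) else 0)"
      using harmonic_mutually_orthogonal[OF f[OF lk(1)] f[OF lk(2)]]
      by (simp only: of_real_mult sq complex_norm_square) simp
  qed
  also have "\<dots> = complex_of_real (\<Sum>l\<in>I. (cmod (c l))\<^sup>2 * (L2_norm (f l))\<^sup>2)"
    using True by (simp add: sum.delta')
  finally show ?thesis by (simp only: of_real_eq_iff)
qed (simp add: L2_norm_def)

text \<open>The factor by which convolution with \<open>g\<close> multiplies harmonics of degree \<open>l\<close>; written over the
  interval it is \<open>2 \<pi>\<close> times the integral of \<open>P\<^bsub>l\<^esub> g\<close>.\<close>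

definition zonal_coeff :: "nat \<Rightarrow> (real^3 \<Rightarrow> complex) \<Rightarrow> complex" where
  "zonal_coeff l g = (LINT y|sphere_measure. of_real (poly (legendre l) (y $ 3)) * g y)"

text \<open>Outside \<open>[-1, 1]\<close> the meridian leaves the sphere, where \<open>g\<close> is arbitrary and possibly not
  measurable. The cut-off makes the profile a Borel function on the line.\<close>

definition clipped_profile :: "(real^3 \<Rightarrow> complex) \<Rightarrow> real \<Rightarrow> complex" where
  "clipped_profile g t = indicator {-1..1} t *\<^sub>R profile g t"

lemma measurable_clipped_profile:
  assumes g: "g \<in> borel_measurable sphere_measure"
  shows "clipped_profile g \<in> borel_measurable borel"
proof -
  let ?m = "\<lambda>t. vector [sqrt (1 - t\<^sup>2), 0, t] :: real^3"
  have alt: "?m = (\<lambda>t. \<chi> i. if i = 1 then sqrt (1 - t\<^sup>2) else if i = 2 then 0 else t)"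
    by (auto simp: fun_eq_iff vec_eq_iff forall_3)
  have "continuous_on UNIV ?m"
    unfolding alt
  proof (rule continuous_on_vec_lambda)
    fix i :: 3
    show "continuous_on UNIV (\<lambda>t. if i = 1 then sqrt (1 - t\<^sup>2) else if i = 2 then 0 else t)"
      by (cases "i = 1"; cases "i = 2") (auto intro!: continuous_intros)
  qed
  then have "?m \<in> borel_measurable borel" by (rule borel_measurable_continuous_onI)
  moreover have "?m \<in> {-1..1} \<rightarrow> S2"
  proof
    fix t :: real assume "t \<in> {-1..1}"
    then have "t\<^sup>2 \<le> 1" by (simp add: abs_square_le_1 abs_le_iff)
    then show "?m t \<in> S2" unfolding sphere_coords by simp
  qed
  ultimately have "?m \<in> measurable (restrict_space borel {-1..1}) (restrict_space borel S2)"
    by (rule measurable_restrict_space3)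
  moreover have "g \<in> borel_measurable (restrict_space borel S2)"
    using g by (simp cong: measurable_cong_sets)
  ultimately have "profile g \<in> borel_measurable (restrict_space borel {-1..1})"
    unfolding profile_def[abs_def] by (rule measurable_compose)
  then show ?thesis
    unfolding clipped_profile_def[abs_def]
    by (subst (asm) borel_measurable_restrict_space_iff) auto
qed

lemma zonal_eq_clipped_profile:
  assumes "zonal g" "x \<in> S2"
  shows "g x = clipped_profile g (x $ 3)"
  using zonal_eq_profile[OF assms] sphere_third_coord[OF assms(2)]
  by (simp add: clipped_profile_def inner_north_pole)

lemma L2_sphere_integrable:
  assumes "g \<in> L2_sphere"
  shows "integrable sphere_measure g"
  using L2_sphere_mult_integrable[OF sphere_poly_L2[OF sphere_poly_const[of 0 1]] assms] by simp

context
  fixes g :: "real^3 \<Rightarrow> complex"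
  assumes g_L2: "g \<in> L2_sphere" and g_zonal: "zonal g"
begin

lemma zonal_profile_regular:
  "clipped_profile g \<in> borel_measurable borel"
  "integrable sphere_measure (\<lambda>x. clipped_profile g (x $ 3))"
  "set_integrable lborel {-1..1} (clipped_profile g)"
proof -
  show m: "clipped_profile g \<in> borel_measurable borel"
    using g_L2 by (intro measurable_clipped_profile) (simp add: L2_sphere_def)
  have "integrable sphere_measure g" by (rule L2_sphere_integrable[OF g_L2])
  then show i: "integrable sphere_measure (\<lambda>x. clipped_profile g (x $ 3))"
    by (rule Bochner_Integration.integrable_cong[THEN iffD1, rotated -1])
       (auto simp: zonal_eq_clipped_profile[OF g_zonal])
  then show "set_integrable lborel {-1..1} (clipped_profile g)"
    using sphere_integrable_zonal_iff[OF m] by simp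
qed

lemma sph_conv_eq_clipped:
  assumes "x \<in> S2"
  shows "sph_conv f g x = (LINT y|sphere_measure. f y * clipped_profile g (x \<bullet> y))"
  unfolding sph_conv_def
proof (rule Bochner_Integration.integral_cong)
  fix y assume "y \<in> space sphere_measure"
  then have "\<bar>x \<bullet> y\<bar> \<le> 1" using Cauchy_Schwarz_ineq2[of x y] assms by simp
  then show "f y * profile g (x \<bullet> y) = f y * clipped_profile g (x \<bullet> y)"
    by (simp add: clipped_profile_def abs_le_iff)
qed simp

lemma sph_conv_harmonic:
  assumes f: "harmonic l f" and x: "x \<in> S2"
  shows "sph_conv f g x = zonal_coeff l g * f x"
proof -
  have "zonal_coeff l g = (LINT y|sphere_measure. of_real (poly (legendre l) (y $ 3)) * clipped_profile g (y $ 3))"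
    unfolding zonal_coeff_def
    by (rule Bochner_Integration.integral_cong) (auto simp: zonal_eq_clipped_profile[OF g_zonal])
  also have "\<dots> = (2 * pi) *\<^sub>R (LINT t:{-1..1}|lborel. of_real (poly (legendre l) t) * clipped_profile g t)"
    using zonal_profile_regular(1)
    by (intro sphere_integral_zonal[where \<psi> = "\<lambda>t. of_real (poly (legendre l) t) * clipped_profile g t"]) measurable
  finally show ?thesis
    unfolding sph_conv_eq_clipped[OF x] funk_hecke[OF f x zonal_profile_regular(1,3)]
    by (simp add: scaleR_conv_of_real)
qed

lemma sph_conv_kernel_integrable:
  assumes x: "x \<in> S2"
  shows "integrable sphere_measure (\<lambda>y. clipped_profile g (x \<bullet> y))"
proof -
  obtain R where R: "orthogonal_transformation R" and Rx: "R north_pole = x"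
    and third: "\<And>y. x \<bullet> R y = y $ 3"
    using rotation_to_point[OF x] by blast
  have "(\<lambda>y. x \<bullet> y) \<in> borel_measurable sphere_measure"
    by (rule measurable_sphere_borel) measurable
  then have meas: "(\<lambda>y. clipped_profile g (x \<bullet> y)) \<in> borel_measurable sphere_measure"
    by (rule measurable_compose[OF _ zonal_profile_regular(1)])
  show ?thesis
    using zonal_profile_regular(2) integrable_distr_eq[OF measurable_orthogonal_sphere[OF R] meas]
    unfolding distr_sphere_orthogonal[OF R] third by simp
qed

text \<open>Convolution with \<open>g\<close> acts diagonally with respect to the degree. The integral may be split
  because each summand is bounded and the kernel is integrable.\<close>

lemma sph_conv_harmonic_sum:
  assumes f: "\<And>l. l \<in> I \<Longrightarrow> harmonic l (f l)" and x: "x \<in> S2"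
  shows "sph_conv (\<lambda>y. \<Sum>l\<in>I. f l y) g x = (\<Sum>l\<in>I. zonal_coeff l g * f l x)"
proof -
  have "sph_conv (\<lambda>y. \<Sum>l\<in>I. f l y) g x = (\<Sum>l\<in>I. sph_conv (f l) g x)"
    unfolding sph_conv_eq_clipped[OF x] sum_distrib_right
    by (intro Bochner_Integration.integral_sum sphere_poly_mult_integrable[OF harmonic_sphere_poly[OF f]]
        sph_conv_kernel_integrable[OF x])
  also have "\<dots> = (\<Sum>l\<in>I. zonal_coeff l g * f l x)"
    by (intro sum.cong refl sph_conv_harmonic f x)
  finally show ?thesis .
qed

end

section \<open>The extremal problem\<close>

lemma sph_harm_0:
  assumes "x \<in> S2"
  shows "sph_harm l 0 x = of_real (sqrt ((2 * real l + 1) / (4 * pi))) * of_real (poly (legendre l) (x $ 3))"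
proof -
  have "assoc_legendre l 0 t = poly (legendre l) t" for t
    unfolding assoc_legendre_def legendre_rodrigues by simp
  then show ?thesis
    using sphere_third_coord[OF assms] by (simp add: sph_harm_def sph_harm_coord_def)
qed

lemma sph_harm_in_span:
  assumes "l \<le> L" "\<bar>m\<bar> \<le> int l"
  shows "sph_harm l m \<in> sph_harm_span L"
proof -
  let ?c = "\<lambda>l' m'. if l' = l \<and> m' = m then 1 else 0 :: complex"
  have "(\<Sum>l'\<le>L. \<Sum>m'\<in>{- int l'..int l'}. ?c l' m' * sph_harm l' m' x) = sph_harm l m x" for x
  proof -
    have "(\<Sum>m'\<in>{- int l'..int l'}. ?c l' m' * sph_harm l' m' x) = (if l' = l then sph_harm l m x else 0)" for l'
    proof (cases "l' = l")
      case True
      have "(\<Sum>m'\<in>{- int l..int l}. (if m' = m then 1 else 0) * sph_harm l m' x)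
          = (\<Sum>m'\<in>{- int l..int l}. if m' = m then sph_harm l m x else 0)"
        by (rule sum.cong) auto
      then show ?thesis using True assms(2) by (simp add: abs_le_iff minus_le_iff)
    qed simp
    then show ?thesis using assms(1) by simp
  qed
  then show ?thesis unfolding sph_harm_span_def by (auto intro!: exI[of _ ?c])
qed

lemma sph_harm_0_nonzero: "\<not> L2_zero (sph_harm l 0)"
proof
  assume "L2_zero (sph_harm l 0)"
  then have "0 = (L2_norm (sph_harm l 0))\<^sup>2" by (simp add: L2_norm_square_zero)
  also have "\<dots> = (LINT x|sphere_measure. (2 * real l + 1) / (4 * pi) * (poly (legendre l) (x $ 3))\<^sup>2)"
    unfolding L2_norm_square
    by (rule Bochner_Integration.integral_cong) (auto simp: sph_harm_0 norm_mult power_mult_distrib)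
  also have "\<dots> = (2 * real l + 1) / (4 * pi) * (LINT x|sphere_measure. poly (legendre l * legendre l) (x $ 3))"
    by (simp add: power2_eq_square)
  also have "(LINT x|sphere_measure. poly (legendre l * legendre l) (x $ 3))
      = (2 * pi) *\<^sub>R (LINT t:{-1..1}|lborel. poly (legendre l * legendre l) t)"
    by (rule sphere_integral_zonal) measurable
  also have "(LINT t:{-1..1}|lborel. poly (legendre l * legendre l) t) = integral {-1..1} (\<lambda>t. (poly (legendre l) t)\<^sup>2)"
    unfolding set_integral_poly by (simp add: power2_eq_square poly_mult[abs_def])
  finally show False
    using integral_poly_square_pos[of "-1" 1 "legendre l"] legendre_nonzero[of l] by (simp add: add_eq_0_iff)
qed

lemma sphere_integral_cap_poly:
  fixes u :: "real poly"
  assumes \<delta>: "-1 \<le> \<delta>"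
  shows "(LINT x|sphere_measure. indicator {\<delta>..} (x $ 3) * poly u (x $ 3)) = 2 * pi * integral {\<delta>..1} (poly u)"
proof -
  have "(LINT x|sphere_measure. indicator {\<delta>..} (x $ 3) * poly u (x $ 3))
      = (2 * pi) *\<^sub>R (LINT t:{-1..1}|lborel. indicator {\<delta>..} t * poly u t)"
    by (rule sphere_integral_zonal) measurable
  also have "(LINT t:{-1..1}|lborel. indicator {\<delta>..} t * poly u t) = (LINT t:{\<delta>..1}|lborel. poly u t)"
    unfolding set_lebesgue_integral_def
    by (rule Bochner_Integration.integral_cong) (use \<delta> in \<open>auto split: split_indicator\<close>)
  finally show ?thesis by (simp add: set_integral_poly)
qed

lemma g_opt_eq:
  assumes "x \<in> S2"
  shows "g_opt L \<delta> x = of_real (indicator {\<delta>..} (x $ 3) * poly (legendre L) (x $ 3))"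
  using assms by (simp add: g_opt_def cap_def inner_north_pole split: split_indicator)

lemma g_opt_in_Z2: "g_opt L \<delta> \<in> Z2 \<delta>"
proof -
  have m: "g_opt L \<delta> \<in> borel_measurable sphere_measure"
  proof (subst measurable_cong)
    show "g_opt L \<delta> x = of_real (indicator {\<delta>..} (x $ 3) * poly (legendre L) (x $ 3))"
      if "x \<in> space sphere_measure" for x using that by (simp add: g_opt_eq)
  qed measurable
  have sp: "sphere_poly L (\<lambda>x. of_real (poly (legendre L) (x $ 3)))"
    by (rule sphere_poly_of_poly[OF degree_legendre_le])
  have "integrable sphere_measure (\<lambda>x. (cmod (of_real (poly (legendre L) (x $ 3))))\<^sup>2)"
    using sphere_poly_L2[OF sp] by (simp add: L2_sphere_def)
  then have "integrable sphere_measure (\<lambda>x. (cmod (g_opt L \<delta> x))\<^sup>2)"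
  proof (rule Bochner_Integration.integrable_bound)
    show "(\<lambda>x. (cmod (g_opt L \<delta> x))\<^sup>2) \<in> borel_measurable sphere_measure"
      using m by measurable
  qed (auto simp: g_opt_def norm_mult inner_north_pole split: split_indicator)
  with m have "g_opt L \<delta> \<in> L2_sphere" by (simp add: L2_sphere_def)
  moreover have "zonal (g_opt L \<delta>)" unfolding zonal_def by (simp add: g_opt_eq)
  ultimately show ?thesis unfolding Z2_def by (auto simp: g_opt_def)
qed

lemma zonal_coeff_g_opt:
  assumes "-1 \<le> \<delta>"
  shows "zonal_coeff l (g_opt L \<delta>)
    = of_real (2 * pi * integral {\<delta>..1} (\<lambda>t. poly (legendre l) t * poly (legendre L) t))"
proof -
  have "zonal_coeff l (g_opt L \<delta>)
      = (LINT x|sphere_measure. complex_of_real (indicator {\<delta>..} (x $ 3) * poly (legendre l * legendre L) (x $ 3)))"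
    unfolding zonal_coeff_def by (rule Bochner_Integration.integral_cong) (auto simp: g_opt_eq)
  also have "\<dots> = of_real (2 * pi * integral {\<delta>..1} (poly (legendre l * legendre L)))"
    unfolding integral_complex_of_real sphere_integral_cap_poly[OF assms] ..
  finally show ?thesis by (simp add: poly_mult[abs_def])
qed

lemma L2_norm_g_opt:
  assumes "-1 \<le> \<delta>"
  shows "(L2_norm (g_opt L \<delta>))\<^sup>2 = 2 * pi * integral {\<delta>..1} (\<lambda>t. (poly (legendre L) t)\<^sup>2)"
proof -
  have "(L2_norm (g_opt L \<delta>))\<^sup>2
      = (LINT x|sphere_measure. indicator {\<delta>..} (x $ 3) * poly (legendre L * legendre L) (x $ 3))"
    unfolding L2_norm_square
    by (rule Bochner_Integration.integral_cong)
       (auto simp: g_opt_eq power2_eq_square norm_mult abs_mult split: split_indicator)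
  also have "\<dots> = 2 * pi * integral {\<delta>..1} (poly (legendre L * legendre L))"
    by (rule sphere_integral_cap_poly[OF assms])
  finally show ?thesis by (simp add: power2_eq_square poly_mult[abs_def])
qed

text \<open>Since \<open>g\<close> vanishes off the cap, \<open>P\<^bsub>L\<^esub>\<close> may be cut off there as well. This makes the multiplier in
  degree \<open>L\<close> an inner product with \<open>g_opt\<close>, and \<open>g_opt\<close> the extremal case of Cauchy-Schwarz.\<close>

lemma zonal_coeff_eq_inner_g_opt:
  assumes "g \<in> Z2 \<delta>"
  shows "zonal_coeff L g = (LINT x|sphere_measure. g_opt L \<delta> x * g x)"
  unfolding zonal_coeff_def
proof (rule integral_cong_AE)
  have [measurable]: "g \<in> borel_measurable sphere_measure" "g_opt L \<delta> \<in> borel_measurable sphere_measure"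
    using assms g_opt_in_Z2[of L \<delta>] by (auto simp: Z2_def L2_sphere_def)
  show "(\<lambda>y. of_real (poly (legendre L) (y $ 3)) * g y) \<in> borel_measurable sphere_measure"
    "(\<lambda>x. g_opt L \<delta> x * g x) \<in> borel_measurable sphere_measure"
    by measurable
  have "AE x in sphere_measure. x \<notin> cap \<delta> north_pole \<longrightarrow> g x = 0" using assms by (simp add: Z2_def)
  then show "AE x in sphere_measure. of_real (poly (legendre L) (x $ 3)) * g x = g_opt L \<delta> x * g x"
    by (rule eventually_mono) (auto simp: g_opt_def inner_north_pole split: split_indicator)
qed

text \<open>It suffices to test with the zonal harmonic of degree \<open>L\<close>, for which the quotient is
  \<open>\<parallel>g\<parallel>\<^sup>2 / \<bar>c\<bar>\<^sup>2\<close> with \<open>c\<close> the multiplier of \<open>g\<close> in degree \<open>L\<close>. By Cauchy-Schwarz \<open>\<bar>c\<bar>\<close> is at most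
  \<open>\<parallel>g_opt\<parallel> \<parallel>g\<parallel>\<close>.\<close>

lemma worst_quotient2_lower_bound:
  assumes g: "g \<in> Z2 \<delta>" "\<not> L2_zero g"
  shows "ennreal (inverse ((L2_norm (g_opt L \<delta>))\<^sup>2)) \<le> worst_quotient2 L g"
proof -
  let ?h = "sph_harm L 0" and ?A = "(L2_norm (g_opt L \<delta>))\<^sup>2" and ?c = "zonal_coeff L g"
  have gL2: "g \<in> L2_sphere" "zonal g" using g by (auto simp: Z2_def)
  have h: "harmonic L ?h" by (rule harmonic_sph_harm) simp
  have "ennreal (inverse ?A) \<le> quotient2 g ?h"
  proof (cases "L2_zero (sph_conv ?h g)")
    case True
    then show ?thesis by (simp add: quotient2_def)
  next
    case False
    have conv: "sph_conv ?h g x = ?c * ?h x" if "x \<in> S2" for x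
      by (rule sph_conv_harmonic[OF gL2 h that])
    have "?c \<noteq> 0"
    proof
      assume "?c = 0"
      then have "AE x in sphere_measure. sph_conv ?h g x = 0" by (intro AE_I2) (simp add: conv)
      with False show False by (simp add: L2_zero_def)
    qed
    then have c: "0 < (cmod ?c)\<^sup>2" by simp
    have hpos: "0 < (L2_norm ?h)\<^sup>2"
      by (rule L2_norm_square_pos[OF sphere_poly_L2[OF harmonic_sphere_poly[OF h]] sph_harm_0_nonzero])
    have "(L2_norm (sph_conv ?h g))\<^sup>2 = (L2_norm (\<lambda>x. ?c * ?h x))\<^sup>2"
      by (rule L2_norm_square_cong) (rule conv)
    also have "\<dots> = (cmod ?c)\<^sup>2 * (L2_norm ?h)\<^sup>2"
      unfolding L2_norm_square by (simp add: norm_mult power_mult_distrib)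
    finally have q: "(L2_norm ?h)\<^sup>2 * (L2_norm g)\<^sup>2 / (L2_norm (sph_conv ?h g))\<^sup>2 = (L2_norm g)\<^sup>2 / (cmod ?c)\<^sup>2"
      using hpos by simp
    have cs: "(cmod ?c)\<^sup>2 \<le> ?A * (L2_norm g)\<^sup>2"
      unfolding zonal_coeff_eq_inner_g_opt[OF g(1)]
      by (rule L2_sphere_cauchy_schwarz) (use gL2 g g_opt_in_Z2[of L \<delta>] in \<open>auto simp: Z2_def\<close>)
    with c have A: "0 < ?A" by (metis less_le_trans mult_eq_0_iff less_le zero_le_power2)
    have "inverse ?A \<le> (L2_norm g)\<^sup>2 / (cmod ?c)\<^sup>2"
      using cs c A by (simp add: field_simps)
    then show ?thesis
      using False by (simp add: quotient2_def q ennreal_leI)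
  qed
  also have "\<dots> \<le> worst_quotient2 L g"
    unfolding worst_quotient2_def
    by (rule SUP_upper) (use sph_harm_0_nonzero sph_harm_in_span in auto)
  finally show ?thesis .
qed

text \<open>Write \<open>A\<close> for the squared norm of \<open>g_opt\<close>. If all multipliers in degrees up to \<open>L\<close> have modulus at
  least \<open>A\<close>, orthogonality of the degrees gives \<open>\<parallel>h * g_opt\<parallel> \<ge> A \<parallel>h\<parallel>\<close>, and the quotient is at most
  \<open>\<parallel>h\<parallel>\<^sup>2 A / (A\<^sup>2 \<parallel>h\<parallel>\<^sup>2)\<close>.\<close>

lemma worst_quotient2_g_opt_le:
  assumes coeff: "\<And>l. l \<le> L \<Longrightarrow> (L2_norm (g_opt L \<delta>))\<^sup>2 \<le> cmod (zonal_coeff l (g_opt L \<delta>))"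
    and pos: "0 < (L2_norm (g_opt L \<delta>))\<^sup>2"
  shows "worst_quotient2 L (g_opt L \<delta>) \<le> ennreal (inverse ((L2_norm (g_opt L \<delta>))\<^sup>2))"
  unfolding worst_quotient2_def
proof (rule SUP_least)
  let ?g = "g_opt L \<delta>" and ?A = "(L2_norm (g_opt L \<delta>))\<^sup>2"
  fix h assume "h \<in> {h \<in> sph_harm_span L. \<not> L2_zero h}"
  then obtain c where h: "h = (\<lambda>x. \<Sum>l\<le>L. \<Sum>m\<in>{- int l..int l}. c l m * sph_harm l m x)"
    and nz: "\<not> L2_zero h" by (auto simp: sph_harm_span_def)
  define f where "f l x = (\<Sum>m\<in>{- int l..int l}. c l m * sph_harm l m x)" for l x
  have hf: "h = (\<lambda>x. \<Sum>l\<le>L. f l x)" by (simp add: h f_def)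
  have harm: "harmonic l (f l)" for l
    unfolding f_def by (intro harmonic_sum harmonic_cmult harmonic_sph_harm) auto
  have g: "?g \<in> L2_sphere" "zonal ?g" using g_opt_in_Z2[of L \<delta>] by (auto simp: Z2_def)
  have norm_h: "(L2_norm h)\<^sup>2 = (\<Sum>l\<le>L. (L2_norm (f l))\<^sup>2)"
    using L2_norm_harmonic_sum[of "{..L}" f "\<lambda>_. 1"] harm by (simp add: hf)
  have "sphere_poly L h"
    unfolding hf by (intro sphere_poly_sum sphere_poly_mono[OF harmonic_sphere_poly[OF harm]]) simp
  then have hpos: "0 < (L2_norm h)\<^sup>2"
    by (intro L2_norm_square_pos nz sphere_poly_L2)
  have "(L2_norm (sph_conv h ?g))\<^sup>2 = (L2_norm (\<lambda>x. \<Sum>l\<le>L. zonal_coeff l ?g * f l x))\<^sup>2"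
    unfolding hf by (intro L2_norm_square_cong sph_conv_harmonic_sum[OF g harm])
  also have "\<dots> = (\<Sum>l\<le>L. (cmod (zonal_coeff l ?g))\<^sup>2 * (L2_norm (f l))\<^sup>2)"
    by (rule L2_norm_harmonic_sum) (rule harm)
  also have "\<dots> \<ge> (\<Sum>l\<le>L. ?A\<^sup>2 * (L2_norm (f l))\<^sup>2)"
    by (intro sum_mono mult_right_mono power_mono coeff) auto
  also have "(\<Sum>l\<le>L. ?A\<^sup>2 * (L2_norm (f l))\<^sup>2) = ?A\<^sup>2 * (L2_norm h)\<^sup>2"
    by (simp only: norm_h sum_distrib_left)
  finally have conv: "?A\<^sup>2 * (L2_norm h)\<^sup>2 \<le> (L2_norm (sph_conv h ?g))\<^sup>2" .
  have "0 < ?A\<^sup>2 * (L2_norm h)\<^sup>2" using pos hpos by (intro mult_pos_pos) auto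
  with conv have cpos: "0 < (L2_norm (sph_conv h ?g))\<^sup>2" by linarith
  then have "\<not> L2_zero (sph_conv h ?g)" using L2_norm_square_zero by fastforce
  moreover have "(L2_norm h)\<^sup>2 * ?A / (L2_norm (sph_conv h ?g))\<^sup>2 \<le> inverse ?A"
  proof -
    have "(L2_norm h)\<^sup>2 * ?A / (L2_norm (sph_conv h ?g))\<^sup>2 \<le> (L2_norm h)\<^sup>2 * ?A / (?A\<^sup>2 * (L2_norm h)\<^sup>2)"
      using conv \<open>0 < ?A\<^sup>2 * (L2_norm h)\<^sup>2\<close> hpos pos by (intro divide_left_mono mult_nonneg_nonneg mult_pos_pos cpos) auto
    also have "\<dots> = inverse ?A"
      using hpos pos by (simp add: power2_eq_square[of "(L2_norm (g_opt L \<delta>))\<^sup>2"] field_simps)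
    finally show ?thesis .
  qed
  ultimately show "quotient2 ?g h \<le> ennreal (inverse ?A)"
    by (simp add: quotient2_def ennreal_leI)
qed

theorem theorem3p2:
  fixes L :: nat and \<delta> :: real
  assumes "L \<ge> 1" and "largest_legendre_zero L \<le> \<delta>" and "\<delta> < 1"
  shows "is_arg_min (worst_quotient2 L) (\<lambda>g. g \<in> Z2 \<delta> \<and> \<not> L2_zero g) (g_opt L \<delta>)
       \<and> C2 L \<delta> = ennreal (inverse (2 * pi * integral {\<delta>..1} (\<lambda>t. (poly (legendre L) t)\<^sup>2)))"
proof -
  let ?g = "g_opt L \<delta>"
  have \<delta>: "-1 \<le> \<delta>"
    using legendre_beyond_largest_zero(3)[OF assms(1,2), of 0] assms(3) by simp
  note norm_g = L2_norm_g_opt[OF \<delta>, of L]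
  have pos: "0 < (L2_norm ?g)\<^sup>2"
    unfolding norm_g using integral_poly_square_pos[OF assms(3) legendre_nonzero[of L]] by simp
  then have g: "?g \<in> Z2 \<delta>" "\<not> L2_zero ?g"
    using g_opt_in_Z2 L2_norm_square_zero by fastforce+
  have "(L2_norm ?g)\<^sup>2 \<le> cmod (zonal_coeff l ?g)" if "l \<le> L" for l
  proof -
    have "integral {\<delta>..1} (\<lambda>t. (poly (legendre L) t)\<^sup>2)
        \<le> integral {\<delta>..1} (\<lambda>t. poly (legendre l) t * poly (legendre L) t)"
    proof (rule integral_le)
      fix t assume t: "t \<in> {\<delta>..1}"
      then have "largest_legendre_zero L \<le> t" "t \<le> 1" using assms by auto
      note beyond = legendre_beyond_largest_zero[OF assms(1) this that]
      show "(poly (legendre L) t)\<^sup>2 \<le> poly (legendre l) t * poly (legendre L) t"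
        unfolding power2_eq_square by (rule mult_right_mono[OF beyond(2,1)])
    qed (auto intro!: integrable_continuous_real continuous_intros)
    then have "(L2_norm ?g)\<^sup>2 \<le> 2 * pi * integral {\<delta>..1} (\<lambda>t. poly (legendre l) t * poly (legendre L) t)"
      unfolding norm_g by simp
    also have "\<dots> \<le> cmod (zonal_coeff l ?g)"
      unfolding zonal_coeff_g_opt[OF \<delta>] norm_of_real by (rule abs_ge_self)
    finally show ?thesis .
  qed
  then have upper: "worst_quotient2 L ?g \<le> ennreal (inverse ((L2_norm ?g)\<^sup>2))"
    using pos by (rule worst_quotient2_g_opt_le)
  have "is_arg_min (worst_quotient2 L) (\<lambda>g. g \<in> Z2 \<delta> \<and> \<not> L2_zero g) ?g"
    unfolding is_arg_min_def
    using g worst_quotient2_lower_bound[of _ \<delta> L] upper by (meson leD order_trans)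
  moreover have "C2 L \<delta> = ennreal (inverse ((L2_norm ?g)\<^sup>2))"
  proof (rule antisym)
    have "C2 L \<delta> \<le> worst_quotient2 L ?g"
      unfolding C2_def by (rule INF_lower) (use g in simp)
    then show "C2 L \<delta> \<le> ennreal (inverse ((L2_norm ?g)\<^sup>2))" using upper by (rule order_trans)
    show "ennreal (inverse ((L2_norm ?g)\<^sup>2)) \<le> C2 L \<delta>"
      unfolding C2_def by (rule INF_greatest) (use worst_quotient2_lower_bound in auto)
  qed
  ultimately show ?thesis unfolding norm_g by simp
qed

end
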